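(* Let $(M,g)$ be an $n$-dimensional compact smooth Riemannian manifold without boundary, and let $\Delta_M$ be its positive Laplace-Beltrami operator. Then there exists a positive constant $C$, depending only on $(M,g)$, such that for every real number $\lambda\geq 1$ and every real-valued eigenfunction $e_\lambda$ of $\Delta_M$ with eigenvalue $\lambda^2$, that is, every smooth, not identically zero function $e_\lambda: M\to\mathbb{R}$ with $\Delta_M e_\lambda=\lambda^2 e_\lambda$, one has $$\frac{\lambda\,\|e_\lambda\|_\infty}{C}\;\leq\;\|\nabla e_\lambda\|_\infty\;\leq\; C\,\lambda\,\|e_\lambda\|_\infty .$$
   Context: The positive Laplace-Beltrami operator is given in local coordinates by $\Delta_M f=-\frac{1}{\sqrt{\mathbf{g}}}\sum_{i,j}\partial_{x_i}\bigl(g^{ij}\sqrt{\mathbf{g}}\,\partial_{x_j}f\bigr)$, where $\mathbf{g}=\det(g_{ij})$ and $(g^{ij})$ is the inverse of the metric matrix $(g_{ij})$; its eigenvalues are nonnegative. The gradient $\nabla f$ of a $C^1$ function $f$ is the vector field with components $\sum_j g^{ij}\,\partial f/\partial x_j$, and its pointwise length satisfies $|\nabla f|^2=\sum_{i,j}g^{ij}(\partial f/\partial x_i)(\partial f/\partial x_j)$. The norms are $\|f\|_\infty=\sup_{x\in M}|f(x)|$ and $\|\nabla f\|_\infty=\sup_{x\in M}|\nabla f(x)|$. *)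

theory Defs
  imports "HOL-Analysis.Analysis"
begin

section \<open>Smooth functions on open subsets of Euclidean space\<close>

text \<open>
  \<open>Ck_on k S f\<close> says that \<open>f\<close> is of class \<open>C\<^sup>k\<close> on \<open>S\<close>; it is only meant for open \<open>S\<close>, since the
  derivatives are taken with respect to the whole space.
\<close>

primrec Ck_on :: "nat \<Rightarrow> 'a::real_normed_vector set \<Rightarrow> ('a \<Rightarrow> 'b::real_normed_vector) \<Rightarrow> bool" where
  "Ck_on 0 S f \<longleftrightarrow> continuous_on S f"
| "Ck_on (Suc k) S f \<longleftrightarrow>
     (\<forall>x\<in>S. f differentiable (at x)) \<and> (\<forall>v. Ck_on k S (\<lambda>x. frechet_derivative f (at x) v))"

definition smooth_on :: "'a::real_normed_vector set \<Rightarrow> ('a \<Rightarrow> 'b::real_normed_vector) \<Rightarrow> bool" where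
  "smooth_on S f \<longleftrightarrow> (\<forall>k. Ck_on k S f)"

definition partial_deriv :: "'n \<Rightarrow> (real ^ 'n \<Rightarrow> real) \<Rightarrow> real ^ 'n \<Rightarrow> real" where
  "partial_deriv i f x = frechet_derivative f (at x) (axis i 1)"


section \<open>Smooth manifolds\<close>

text \<open>
  A chart is a pair of a domain \<open>U\<close> and a coordinate map, of which only the restriction to \<open>U\<close>
  matters. All charts map to \<open>real ^ 'n\<close>, so there is no boundary and the dimension is \<open>CARD('n)\<close>.
\<close>

type_synonym ('m, 'n) chart = "'m set \<times> ('m \<Rightarrow> real ^ 'n)"

abbreviation chart_dom :: "('m, 'n) chart \<Rightarrow> 'm set" where
  "chart_dom c \<equiv> fst c"

abbreviation coord :: "('m, 'n) chart \<Rightarrow> 'm \<Rightarrow> real ^ 'n" where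
  "coord c \<equiv> snd c"

definition chart_image :: "('m, 'n) chart \<Rightarrow> (real ^ 'n) set" where
  "chart_image c = coord c ` chart_dom c"

definition coord_inv :: "('m, 'n) chart \<Rightarrow> real ^ 'n \<Rightarrow> 'm" where
  "coord_inv c = inv_into (chart_dom c) (coord c)"

definition is_chart :: "'m topology \<Rightarrow> ('m, 'n::finite) chart \<Rightarrow> bool" where
  "is_chart X c \<longleftrightarrow>
     openin X (chart_dom c) \<and> open (chart_image c) \<and>
     homeomorphic_map (subtopology X (chart_dom c)) (top_of_set (chart_image c)) (coord c)"

definition transition :: "('m, 'n) chart \<Rightarrow> ('m, 'n) chart \<Rightarrow> real ^ 'n \<Rightarrow> real ^ 'n" where
  "transition c d = coord d \<circ> coord_inv c"

text \<open>
  The atlas need not be maximal. Compatibility is required for all ordered pairs of charts, so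
  the transition maps are diffeomorphisms.
\<close>

definition smooth_atlas :: "'m topology \<Rightarrow> ('m, 'n::finite) chart set \<Rightarrow> bool" where
  "smooth_atlas X \<A> \<longleftrightarrow>
     (\<forall>c\<in>\<A>. is_chart X c) \<and>
     (\<Union>c\<in>\<A>. chart_dom c) = topspace X \<and>
     (\<forall>c\<in>\<A>. \<forall>d\<in>\<A>. smooth_on (coord c ` (chart_dom c \<inter> chart_dom d)) (transition c d))"


section \<open>Riemannian manifolds\<close>

text \<open>
  The metric is given by its component matrices: \<open>metric_tensor M c p\<close> is the matrix \<open>(g\<^sub>i\<^sub>j)\<close> at the
  point \<open>p\<close> in the chart \<open>c\<close>. It is relevant only for \<open>c\<close> in the atlas and \<open>p\<close> in the domain of \<open>c\<close>.
\<close>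

record ('m, 'n::finite) riem_mfd =
  mfd_top :: "'m topology"
  atlas :: "('m, 'n) chart set"
  metric_tensor :: "('m, 'n) chart \<Rightarrow> 'm \<Rightarrow> real ^ 'n ^ 'n"

abbreviation points :: "('m, 'n::finite) riem_mfd \<Rightarrow> 'm set" where
  "points M \<equiv> topspace (mfd_top M)"

definition chart_jacobian :: "('m, 'n::finite) chart \<Rightarrow> ('m, 'n) chart \<Rightarrow> 'm \<Rightarrow> real ^ 'n ^ 'n" where
  "chart_jacobian c d p = jacobian (transition c d) (at (coord c p))"

text \<open>
  The last condition is the transformation law of a covariant 2-tensor, which makes
  \<open>\<Sum>i j. g\<^sub>i\<^sub>j v\<^sup>i w\<^sup>j\<close> independent of the chart.
\<close>

definition is_riemannian_metric :: "('m, 'n::finite) riem_mfd \<Rightarrow> bool" where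
  "is_riemannian_metric M \<longleftrightarrow>
     (\<forall>c\<in>atlas M. \<forall>p\<in>chart_dom c.
        transpose (metric_tensor M c p) = metric_tensor M c p \<and>
        (\<forall>v. v \<noteq> 0 \<longrightarrow> v \<bullet> (metric_tensor M c p *v v) > 0)) \<and>
     (\<forall>c\<in>atlas M. \<forall>i j. smooth_on (chart_image c) (\<lambda>x. metric_tensor M c (coord_inv c x) $ i $ j)) \<and>
     (\<forall>c\<in>atlas M. \<forall>d\<in>atlas M. \<forall>p\<in>chart_dom c \<inter> chart_dom d.
        metric_tensor M c p = transpose (chart_jacobian c d p) ** metric_tensor M d p ** chart_jacobian c d p)"

definition riemannian_manifold :: "('m, 'n::finite) riem_mfd \<Rightarrow> bool" where
  "riemannian_manifold M \<longleftrightarrow>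
     Hausdorff_space (mfd_top M) \<and> second_countable (mfd_top M) \<and>
     smooth_atlas (mfd_top M) (atlas M) \<and> is_riemannian_metric M"

definition compact_riemannian_manifold :: "('m, 'n::finite) riem_mfd \<Rightarrow> bool" where
  "compact_riemannian_manifold M \<longleftrightarrow> riemannian_manifold M \<and> compact_space (mfd_top M)"


section \<open>Functions on a manifold\<close>

definition local_rep :: "('m \<Rightarrow> real) \<Rightarrow> ('m, 'n) chart \<Rightarrow> real ^ 'n \<Rightarrow> real" where
  "local_rep f c = f \<circ> coord_inv c"

definition smooth_fun :: "('m, 'n::finite) riem_mfd \<Rightarrow> ('m \<Rightarrow> real) \<Rightarrow> bool" where
  "smooth_fun M f \<longleftrightarrow> (\<forall>c\<in>atlas M. smooth_on (chart_image c) (local_rep f c))"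

definition sup_norm :: "('m, 'n::finite) riem_mfd \<Rightarrow> ('m \<Rightarrow> real) \<Rightarrow> real" where
  "sup_norm M f = (SUP p\<in>points M. \<bar>f p\<bar>)"

definition inv_metric :: "('m, 'n::finite) riem_mfd \<Rightarrow> ('m, 'n) chart \<Rightarrow> 'm \<Rightarrow> real ^ 'n ^ 'n" where
  "inv_metric M c p = matrix_inv (metric_tensor M c p)"

definition gradient :: "('m, 'n::finite) riem_mfd \<Rightarrow> ('m \<Rightarrow> real) \<Rightarrow> ('m, 'n) chart \<Rightarrow> 'm \<Rightarrow> real ^ 'n" where
  "gradient M f c p =
     (\<chi> i. \<Sum>j\<in>UNIV. inv_metric M c p $ i $ j * partial_deriv j (local_rep f c) (coord c p))"

definition gradient_length_in ::
    "('m, 'n::finite) riem_mfd \<Rightarrow> ('m \<Rightarrow> real) \<Rightarrow> ('m, 'n) chart \<Rightarrow> 'm \<Rightarrow> real" where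
  "gradient_length_in M f c p =
     sqrt (\<Sum>i\<in>UNIV. \<Sum>j\<in>UNIV. metric_tensor M c p $ i $ j * gradient M f c p $ i * gradient M f c p $ j)"

text \<open>The choice of the chart is immaterial, see \<open>gradient_length_eq\<close> below.\<close>

definition gradient_length :: "('m, 'n::finite) riem_mfd \<Rightarrow> ('m \<Rightarrow> real) \<Rightarrow> 'm \<Rightarrow> real" where
  "gradient_length M f p =
     gradient_length_in M f (SOME c. c \<in> atlas M \<and> p \<in> chart_dom c) p"

definition laplacian_in ::
    "('m, 'n::finite) riem_mfd \<Rightarrow> ('m \<Rightarrow> real) \<Rightarrow> ('m, 'n) chart \<Rightarrow> 'm \<Rightarrow> real" where
  "laplacian_in M f c p =
     (let G = (\<lambda>x. metric_tensor M c (coord_inv c x));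
          Ginv = (\<lambda>x. inv_metric M c (coord_inv c x))
      in - (1 / sqrt (det (G (coord c p)))) *
           (\<Sum>i\<in>UNIV. \<Sum>j\<in>UNIV.
              partial_deriv i
                (\<lambda>x. Ginv x $ i $ j * sqrt (det (G x)) * partial_deriv j (local_rep f c) x)
                (coord c p)))"

text \<open>
  The coordinate expression transforms as a scalar under a change of charts. Rather than choosing
  a chart at every point, the operator is introduced as a relation (in the style of
  \<open>has_derivative\<close>): \<open>h\<close> is the image of \<open>f\<close> under the positive Laplace-Beltrami operator if it is given by
  the coordinate expression in every chart.
\<close>

definition has_laplacian :: "('m, 'n::finite) riem_mfd \<Rightarrow> ('m \<Rightarrow> real) \<Rightarrow> ('m \<Rightarrow> real) \<Rightarrow> bool" where
  "has_laplacian M f h \<longleftrightarrow> (\<forall>c\<in>atlas M. \<forall>p\<in>chart_dom c. laplacian_in M f c p = h p)"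

definition eigenfunction :: "('m, 'n::finite) riem_mfd \<Rightarrow> real \<Rightarrow> ('m \<Rightarrow> real) \<Rightarrow> bool" where
  "eigenfunction M \<mu> f \<longleftrightarrow>
     smooth_fun M f \<and> (\<exists>p\<in>points M. f p \<noteq> 0) \<and> has_laplacian M f (\<lambda>p. \<mu> * f p)"

section \<open>The length of the gradient\<close>

lemma riemannian_metric_posdef:
  assumes "riemannian_manifold M" "c \<in> atlas M" "p \<in> chart_dom c"
  shows "transpose (metric_tensor M c p) = metric_tensor M c p" "invertible (metric_tensor M c p)"
proof -
  have sym: "transpose (metric_tensor M c p) = metric_tensor M c p"
    and pos: "\<And>v. v \<noteq> 0 \<Longrightarrow> v \<bullet> (metric_tensor M c p *v v) > 0"
    using assms unfolding riemannian_manifold_def is_riemannian_metric_def by blast+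
  have "\<forall>v. metric_tensor M c p *v v = 0 \<longrightarrow> v = 0"
    using pos by (metis inner_zero_right less_irrefl)
  then show "invertible (metric_tensor M c p)"
    using matrix_left_invertible_ker invertible_left_inverse by blast
  show "transpose (metric_tensor M c p) = metric_tensor M c p" by (rule sym)
qed

lemma invertible_matrix_inv_right:
  fixes A :: "real ^ 'n ^ 'n"
  assumes "invertible A"
  shows "A ** matrix_inv A = mat 1"
  using assms unfolding invertible_def matrix_inv_def by (metis (mono_tags, lifting) someI_ex)

definition differential_vec :: "('m \<Rightarrow> real) \<Rightarrow> ('m, 'n::finite) chart \<Rightarrow> 'm \<Rightarrow> real ^ 'n" where
  "differential_vec f c p = (\<chi> i. partial_deriv i (local_rep f c) (coord c p))"

lemma gradient_eq_matrix_vector: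
  "gradient M f c p = inv_metric M c p *v differential_vec f c p"
  by (simp add: gradient_def differential_vec_def matrix_vector_mult_def)

lemma metric_gradient:
  assumes "riemannian_manifold M" "c \<in> atlas M" "p \<in> chart_dom c"
  shows "metric_tensor M c p *v gradient M f c p = differential_vec f c p"
  using invertible_matrix_inv_right[OF riemannian_metric_posdef(2)[OF assms]]
  by (simp add: gradient_eq_matrix_vector matrix_vector_mul_assoc inv_metric_def)

lemma gradient_length_in_inner:
  assumes "riemannian_manifold M" "c \<in> atlas M" "p \<in> chart_dom c"
  shows "gradient_length_in M f c p = sqrt (gradient M f c p \<bullet> differential_vec f c p)"
proof -
  let ?w = "gradient M f c p"
  have "(\<Sum>i\<in>UNIV. \<Sum>j\<in>UNIV. metric_tensor M c p $ i $ j * ?w $ i * ?w $ j) = ?w \<bullet> (metric_tensor M c p *v ?w)"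
    by (simp add: inner_vec_def matrix_vector_mult_def sum_distrib_left mult_ac)
  then show ?thesis
    by (simp add: gradient_length_in_def metric_gradient[OF assms])
qed

lemma gradient_length_in_square:
  assumes "riemannian_manifold M" "c \<in> atlas M" "p \<in> chart_dom c"
  shows "(gradient_length_in M f c p)\<^sup>2 =
     (\<Sum>i\<in>UNIV. \<Sum>j\<in>UNIV. inv_metric M c p $ i $ j *
        partial_deriv i (local_rep f c) (coord c p) * partial_deriv j (local_rep f c) (coord c p))"
proof -
  let ?w = "gradient M f c p"
  have "0 \<le> ?w \<bullet> (metric_tensor M c p *v ?w)"
    using assms unfolding riemannian_manifold_def is_riemannian_metric_def
    by (metis inner_zero_left less_eq_real_def)
  then have "(gradient_length_in M f c p)\<^sup>2 = ?w \<bullet> differential_vec f c p"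
    by (simp add: gradient_length_in_inner[OF assms] metric_gradient[OF assms])
  then show ?thesis
    by (simp add: gradient_def differential_vec_def inner_vec_def sum_distrib_left sum_distrib_right mult_ac)
qed

lemma chart_coord_inv:
  assumes "is_chart X c" "p \<in> chart_dom c"
  shows "coord_inv c (coord c p) = p" "coord c p \<in> chart_image c"
proof -
  have "chart_dom c \<subseteq> topspace X"
    using assms(1) openin_subset unfolding is_chart_def by blast
  then have "inj_on (coord c) (chart_dom c)"
    using assms(1) unfolding is_chart_def homeomorphic_eq_everything_map
    by (simp add: Int_absorb1)
  then show "coord_inv c (coord c p) = p"
    using assms(2) by (simp add: coord_inv_def)
  show "coord c p \<in> chart_image c"
    using assms(2) by (simp add: chart_image_def)
qed

lemma open_coord_overlap:
  assumes "is_chart X c" "is_chart X d"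
  shows "open (coord c ` (chart_dom c \<inter> chart_dom d))"
proof -
  have "openin (subtopology X (chart_dom c)) (chart_dom c \<inter> chart_dom d)"
    using assms openin_subtopology_Int2 unfolding is_chart_def by blast
  then have "openin (top_of_set (chart_image c)) (coord c ` (chart_dom c \<inter> chart_dom d))"
    using assms(1) unfolding is_chart_def
    by (metis homeomorphic_map_openness_eq)
  then show ?thesis
    using assms(1) openin_open_trans unfolding is_chart_def by blast
qed

lemma smooth_on_differentiable:
  assumes "smooth_on S f" "x \<in> S"
  shows "f differentiable (at x)"
  using assms unfolding smooth_on_def by (metis Ck_on.simps(2))

lemma differential_vec_transform:
  assumes M: "riemannian_manifold M" and f: "smooth_fun M f"
    and c: "c \<in> atlas M" "p \<in> chart_dom c" and d: "d \<in> atlas M" "p \<in> chart_dom d"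
  shows "differential_vec f c p = transpose (chart_jacobian c d p) *v differential_vec f d p"
proof -
  let ?S = "coord c ` (chart_dom c \<inter> chart_dom d)"
  let ?t = "transition c d" and ?x = "coord c p" and ?u = "local_rep f d"
  have ch: "is_chart (mfd_top M) c" "is_chart (mfd_top M) d"
    and smt: "smooth_on ?S ?t"
    using M c d unfolding riemannian_manifold_def smooth_atlas_def by blast+
  have x: "?x \<in> ?S" using c d by blast
  have dt: "?t differentiable (at ?x)"
    using smooth_on_differentiable[OF smt x] .
  have tx: "?t ?x = coord d p"
    using chart_coord_inv[OF ch(1) c(2)] by (simp add: transition_def)
  have du: "?u differentiable (at (?t ?x))"
    using smooth_on_differentiable f d(1) chart_coord_inv(2)[OF ch(2) d(2)] tx
    unfolding smooth_fun_def by metis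
  have eq: "(?u \<circ> ?t) y = local_rep f c y" if "y \<in> ?S" for y
  proof -
    obtain q where q: "q \<in> chart_dom c" "q \<in> chart_dom d" "y = coord c q"
      using \<open>y \<in> ?S\<close> by blast
    then show ?thesis
      using chart_coord_inv(1)[OF ch(1) q(1)] chart_coord_inv(1)[OF ch(2) q(2)]
      by (simp add: local_rep_def transition_def)
  qed
  have "(?u \<circ> ?t) differentiable (at ?x)"
    using differentiable_chain_at[OF dt du] .
  then have "frechet_derivative (?u \<circ> ?t) (at ?x) = frechet_derivative (local_rep f c) (at ?x)"
    by (rule frechet_derivative_transform_within_open[OF _ open_coord_overlap[OF ch] x eq])
  then have fd: "frechet_derivative (local_rep f c) (at ?x) =
      frechet_derivative ?u (at (coord d p)) \<circ> frechet_derivative ?t (at ?x)"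
    using frechet_derivative_compose[OF dt du] tx by simp
  have lin: "linear (frechet_derivative ?u (at (coord d p)))"
    using du tx linear_frechet_derivative by metis
  have expand: "frechet_derivative ?u (at (coord d p)) v =
      (\<Sum>k\<in>UNIV. v $ k * partial_deriv k ?u (coord d p))" for v
  proof -
    have "frechet_derivative ?u (at (coord d p)) v =
        frechet_derivative ?u (at (coord d p)) (\<Sum>k\<in>UNIV. v $ k *\<^sub>R axis k 1)"
      using basis_expansion[of v] by (simp add: scalar_mult_eq_scaleR)
    also have "\<dots> = (\<Sum>k\<in>UNIV. v $ k * partial_deriv k ?u (coord d p))"
      using lin by (simp add: linear_sum linear_scale partial_deriv_def)
    finally show ?thesis .
  qed
  show ?thesis
    by (simp add: vec_eq_iff differential_vec_def partial_deriv_def[of _ "local_rep f c"] fd expand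
        matrix_vector_mult_def transpose_def chart_jacobian_def jacobian_def matrix_def)
qed

lemma gradient_length_in_chart_independent:
  assumes M: "riemannian_manifold M" and f: "smooth_fun M f"
    and c: "c \<in> atlas M" "p \<in> chart_dom c" and d: "d \<in> atlas M" "p \<in> chart_dom d"
  shows "gradient_length_in M f c p = gradient_length_in M f d p"
proof -
  let ?J = "chart_jacobian c d p"
  let ?v = "gradient M f c p" and ?w = "gradient M f d p"
  let ?D = "differential_vec f d p"
  have g: "metric_tensor M c p = transpose ?J ** metric_tensor M d p ** ?J"
    using M c d unfolding riemannian_manifold_def is_riemannian_metric_def by blast
  have "det (metric_tensor M c p) \<noteq> 0"
    using riemannian_metric_posdef(2)[OF M c] invertible_det_nz by blast
  then have "det ?J \<noteq> 0"
    using g by (auto simp: det_mul)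
  then have "invertible (transpose ?J)"
    by (simp add: invertible_det_nz)
  then have injT: "x = y" if "transpose ?J *v x = transpose ?J *v y" for x y
    using that by (metis invertible_def matrix_vector_mul_assoc matrix_vector_mul_lid)
  have injG: "x = y" if "metric_tensor M d p *v x = metric_tensor M d p *v y" for x y
    using that riemannian_metric_posdef(2)[OF M d]
    by (metis invertible_def matrix_vector_mul_assoc matrix_vector_mul_lid)
  have "transpose ?J *v (metric_tensor M d p *v (?J *v ?v)) = transpose ?J *v ?D"
    using metric_gradient[OF M c, of f] differential_vec_transform[OF M f c d] g
    by (simp add: matrix_vector_mul_assoc matrix_mul_assoc)
  then have "metric_tensor M d p *v (?J *v ?v) = ?D" by (rule injT)
  also have "?D = metric_tensor M d p *v ?w" using metric_gradient[OF M d, of f] by simp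
  finally have "?J *v ?v = ?w" by (rule injG)
  moreover have "?v \<bullet> (transpose ?J *v ?D) = (?J *v ?v) \<bullet> ?D"
    by (metis dot_lmul_matrix inner_commute matrix_vector_mul_lid transpose_transpose
        transpose_matrix_vector)
  ultimately show ?thesis
    using differential_vec_transform[OF M f c d]
    by (simp add: gradient_length_in_inner[OF M c] gradient_length_in_inner[OF M d])
qed

lemma gradient_length_eq:
  assumes "riemannian_manifold M" "smooth_fun M f" "c \<in> atlas M" "p \<in> chart_dom c"
  shows "gradient_length M f p = gradient_length_in M f c p"
proof -
  define d where "d = (SOME c. c \<in> atlas M \<and> p \<in> chart_dom c)"
  have "d \<in> atlas M \<and> p \<in> chart_dom d"
    unfolding d_def by (rule someI[of _ c]) (use assms in simp)
  then show ?thesis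
    using gradient_length_in_chart_independent[OF assms(1,2) _ _ assms(3,4)]
    by (simp add: gradient_length_def d_def)
qed

end

theory Submission
  imports Defs
begin

text \<open>
  Both inequalities follow from the maximum principle, applied to the eigenvalue equation in charts.
  There the Laplacian is minus a second-order elliptic operator \<open>L\<close> with smooth coefficients, so an
  eigenfunction \<open>u\<close> with eigenvalue \<open>\<mu> = l\<^sup>2\<close> solves \<open>L u = - \<mu> u\<close>
  (\<open>laplacian_in_eq_second_order_op\<close>, \<open>eigenfunction_local_equation\<close>).

  The upper bound for the gradient is Bernstein's method. Consider the global function
  \<open>F = |\<nabla>u|\<^sup>2 + A \<mu> u\<^sup>2\<close> with a large constant \<open>A\<close>. At a maximum point of \<open>F\<close> one has \<open>L F \<le> 0\<close>.
  The expansion of \<open>L F\<close> contains the term \<open>2 (A - 1) \<mu> |\<nabla>u|\<^sup>2\<close>, a term bounded below by the square of the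
  Hessian, the negative term \<open>- 2 A \<mu>\<^sup>2 u\<^sup>2\<close>, and errors of the orders of Hessian times gradient and gradient
  squared, which arise from the derivatives of the coefficients. The errors are absorbed by the first two terms,
  and \<open>|\<nabla>u|\<^sup>2 \<le> A \<mu> u\<^sup>2\<close> results at the maximum point of \<open>F\<close>
  (\<open>bernstein_gradient_bound_at_max\<close>). Hence \<open>|\<nabla>u|\<^sup>2 \<le> F \<le> 2 A \<mu> sup |u|\<^sup>2\<close> everywhere.

  For the lower bound, let \<open>u\<close> attain the maximum \<open>m > 0\<close> of its modulus at \<open>z\<close>. On a coordinate ball of radius
  proportional to \<open>1 / l\<close> either \<open>u\<close> falls below \<open>m / 2\<close>, or \<open>L u\<close> is at most \<open>- l\<^sup>2 m / 2\<close>. In the second case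
  a multiple of the squared distance, of size \<open>l\<^sup>2 m\<close>, serves as a barrier and forces \<open>u\<close> to decrease by a fixed
  fraction of \<open>m\<close> between the centre and some boundary point. In both cases the gradient reaches the
  order \<open>l m\<close> (\<open>barrier_lower_bound\<close>).

  The constants in these two arguments depend only on bounds for the coefficients of \<open>L\<close> on a compact coordinate
  ball and on their ellipticity there (\<open>local_gradient_estimates\<close>). Finitely many such balls cover the manifold
  (\<open>compact_space_uniform_const\<close>).
\<close>

section \<open>Calculus of smooth functions\<close>

lemma Ck_on_SucD:
  assumes "Ck_on (Suc k) S f" "x \<in> S"
  shows "(f has_derivative frechet_derivative f (at x)) (at x)"
  using assms by (simp add: frechet_derivative_works)

lemma Ck_on_cong:
  assumes "open S" "\<And>x. x \<in> S \<Longrightarrow> f x = g x" "Ck_on k S f"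
  shows "Ck_on k S g"
  using assms(2,3)
proof (induction k arbitrary: f g)
  case 0
  then show ?case using continuous_on_cong[of S S f g] by simp
next
  case (Suc k)
  have d: "f differentiable at x" if "x \<in> S" for x using Suc.prems that by simp
  have d': "g differentiable at x" if "x \<in> S" for x
    using has_derivative_transform_within_open[OF Ck_on_SucD[OF Suc.prems(2) that] assms(1) that Suc.prems(1)]
    by (simp add: differentiable_def) blast
  have "Ck_on k S (\<lambda>x. frechet_derivative g (at x) v)" for v
  proof (rule Suc.IH)
    show "Ck_on k S (\<lambda>x. frechet_derivative f (at x) v)" using Suc.prems by simp
    show "frechet_derivative f (at x) v = frechet_derivative g (at x) v" if "x \<in> S" for x
      using frechet_derivative_transform_within_open[OF d[OF that] assms(1) that Suc.prems(1)] by simp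
  qed
  then show ?case using d' by simp
qed

lemma Ck_on_Suc_imp: "Ck_on (Suc k) S f \<Longrightarrow> Ck_on k S f"
proof (induction k arbitrary: f)
  case 0
  then show ?case
    by (auto intro!: differentiable_imp_continuous_on simp: differentiable_on_def
        differentiable_at_withinI)
next
  case (Suc k)
  then show ?case by (simp only: Ck_on.simps) blast
qed

lemma Ck_on_SucI:
  assumes S: "open S" and d: "\<And>x. x \<in> S \<Longrightarrow> (f has_derivative D x) (at x)"
    and "\<And>v. Ck_on k S (\<lambda>x. D x v)"
  shows "Ck_on (Suc k) S f"
proof -
  have "Ck_on k S (\<lambda>x. frechet_derivative f (at x) v)" for v
    by (rule Ck_on_cong[OF S _ assms(3)[of v]]) (use frechet_derivative_at[OF d] in metis)
  then show ?thesis using d by (auto simp: differentiable_def)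
qed

lemma Ck_on_const: "Ck_on k S (\<lambda>x. c)"
  by (induction k arbitrary: c) auto

lemma Ck_on_add:
  assumes S: "open S" "Ck_on k S f" "Ck_on k S g"
  shows "Ck_on k S (\<lambda>x. f x + g x)"
  using assms(2,3)
proof (induction k arbitrary: f g)
  case 0
  then show ?case by (simp add: continuous_on_add)
next
  case (Suc k)
  show ?case
    by (rule Ck_on_SucI[OF S(1) has_derivative_add[OF Ck_on_SucD[OF Suc.prems(1)] Ck_on_SucD[OF Suc.prems(2)]]])
      (use Suc in auto)
qed

lemma Ck_on_mult:
  fixes f g :: "'a::real_normed_vector \<Rightarrow> real"
  assumes S: "open S" "Ck_on k S f" "Ck_on k S g"
  shows "Ck_on k S (\<lambda>x. f x * g x)"
  using assms(2,3)
proof (induction k arbitrary: f g)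
  case 0
  then show ?case by (simp add: continuous_on_mult)
next
  case (Suc k)
  show ?case
    by (rule Ck_on_SucI[OF S(1) has_derivative_mult[OF Ck_on_SucD[OF Suc.prems(1)] Ck_on_SucD[OF Suc.prems(2)]]])
      (use Suc Ck_on_Suc_imp[OF Suc.prems(1)] Ck_on_Suc_imp[OF Suc.prems(2)] in \<open>auto intro!: Ck_on_add S(1)\<close>)
qed

lemma Ck_on_inverse:
  fixes f :: "'a::real_normed_vector \<Rightarrow> real"
  assumes S: "open S" "Ck_on k S f" and nz: "\<And>x. x \<in> S \<Longrightarrow> f x \<noteq> 0"
  shows "Ck_on k S (\<lambda>x. inverse (f x))"
  using assms(2)
proof (induction k)
  case 0
  then show ?case using nz by (simp add: continuous_on_inverse)
next
  case (Suc k)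
  have inv: "Ck_on k S (\<lambda>x. inverse (f x))" using Suc.IH Ck_on_Suc_imp[OF Suc.prems] .
  have "Ck_on k S (\<lambda>x. - 1 * (inverse (f x) * frechet_derivative f (at x) v * inverse (f x)))" for v
    by (intro Ck_on_mult Ck_on_const S(1) inv) (use Suc.prems in simp)
  then show ?case
    by (intro Ck_on_SucI[OF S(1) Deriv.has_derivative_inverse[OF nz Ck_on_SucD[OF Suc.prems]]]) auto
qed

lemma Ck_on_sqrt:
  fixes f :: "'a::real_normed_vector \<Rightarrow> real"
  assumes S: "open S" "Ck_on k S f" and pos: "\<And>x. x \<in> S \<Longrightarrow> f x > 0"
  shows "Ck_on k S (\<lambda>x. sqrt (f x))"
  using assms(2)
proof (induction k)
  case 0
  then show ?case by (simp add: continuous_on_real_sqrt)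
next
  case (Suc k)
  have "Ck_on k S (\<lambda>x. sqrt (f x))" using Suc.IH Ck_on_Suc_imp[OF Suc.prems] .
  then have inv: "Ck_on k S (\<lambda>x. inverse (sqrt (f x)))"
    by (rule Ck_on_inverse[OF S(1)]) (use pos in force)
  have "Ck_on k S (\<lambda>x. frechet_derivative f (at x) v * (inverse (sqrt (f x)) * (1/2)))" for v
    by (intro Ck_on_mult Ck_on_const S(1) inv) (use Suc.prems in simp)
  moreover have "((\<lambda>x. sqrt (f x)) has_derivative
      (\<lambda>v. frechet_derivative f (at x) v * (inverse (sqrt (f x)) * (1/2)))) (at x)" if "x \<in> S" for x
    using has_derivative_real_sqrt[OF pos[OF that] Ck_on_SucD[OF Suc.prems that]]
    by (simp add: field_simps)
  ultimately show ?case by (intro Ck_on_SucI[OF S(1)]) auto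
qed

lemma smooth_on_const: "smooth_on S (\<lambda>x. c)"
  by (simp add: smooth_on_def Ck_on_const)

lemma smooth_on_add: "open S \<Longrightarrow> smooth_on S f \<Longrightarrow> smooth_on S g \<Longrightarrow> smooth_on S (\<lambda>x. f x + g x)"
  by (simp add: smooth_on_def Ck_on_add)

lemma smooth_on_mult:
  fixes f g :: "'a::real_normed_vector \<Rightarrow> real"
  shows "open S \<Longrightarrow> smooth_on S f \<Longrightarrow> smooth_on S g \<Longrightarrow> smooth_on S (\<lambda>x. f x * g x)"
  by (simp add: smooth_on_def Ck_on_mult)

lemma smooth_on_diff:
  fixes f g :: "'a::real_normed_vector \<Rightarrow> real"
  assumes "open S" "smooth_on S f" "smooth_on S g"
  shows "smooth_on S (\<lambda>x. f x - g x)"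
  using smooth_on_add[OF assms(1,2) smooth_on_mult[OF assms(1) smooth_on_const assms(3)], of "- 1"] by simp

lemma smooth_on_divide:
  fixes f g :: "'a::real_normed_vector \<Rightarrow> real"
  assumes "open S" "smooth_on S f" "smooth_on S g" "\<And>x. x \<in> S \<Longrightarrow> g x \<noteq> 0"
  shows "smooth_on S (\<lambda>x. f x / g x)"
  using assms smooth_on_mult[of S f "\<lambda>x. inverse (g x)"]
  by (simp add: divide_inverse smooth_on_def Ck_on_inverse)

lemma smooth_on_sqrt:
  fixes f :: "'a::real_normed_vector \<Rightarrow> real"
  assumes "open S" "smooth_on S f" "\<And>x. x \<in> S \<Longrightarrow> f x > 0"
  shows "smooth_on S (\<lambda>x. sqrt (f x))"
  using assms by (simp add: smooth_on_def Ck_on_sqrt)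

lemma smooth_on_sum:
  assumes "open S" "\<And>i. i \<in> I \<Longrightarrow> smooth_on S (f i)"
  shows "smooth_on S (\<lambda>x. \<Sum>i\<in>I. f i x)"
  using assms(2)
  by (induction I rule: infinite_finite_induct) (auto intro: smooth_on_const smooth_on_add[OF assms(1)])

lemma smooth_on_prod:
  fixes f :: "'i \<Rightarrow> 'a::real_normed_vector \<Rightarrow> real"
  assumes "open S" "\<And>i. i \<in> I \<Longrightarrow> smooth_on S (f i)"
  shows "smooth_on S (\<lambda>x. \<Prod>i\<in>I. f i x)"
  using assms(2)
  by (induction I rule: infinite_finite_induct) (auto intro: smooth_on_const smooth_on_mult[OF assms(1)])

lemma smooth_on_cong:
  assumes "open S" "\<And>x. x \<in> S \<Longrightarrow> f x = g x" "smooth_on S f"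
  shows "smooth_on S g"
  using assms unfolding smooth_on_def by (metis Ck_on_cong)

lemma Ck_on_subset: "Ck_on k S f \<Longrightarrow> T \<subseteq> S \<Longrightarrow> Ck_on k T f"
  by (induction k arbitrary: f) (auto intro: continuous_on_subset)

lemma smooth_on_subset: "smooth_on S f \<Longrightarrow> T \<subseteq> S \<Longrightarrow> smooth_on T f"
  unfolding smooth_on_def by (blast intro: Ck_on_subset)

lemma smooth_on_nth: "open S \<Longrightarrow> smooth_on S (\<lambda>x :: real ^ 'n. x $ i)"
  unfolding smooth_on_def
proof
  fix k assume S: "open S"
  have "Ck_on (Suc k) S (\<lambda>x :: real ^ 'n. x $ i)"
    by (rule Ck_on_SucI[OF S bounded_linear_imp_has_derivative[OF bounded_linear_vec_nth]])
      (rule Ck_on_const)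
  then show "Ck_on k S (\<lambda>x :: real ^ 'n. x $ i)" by (rule Ck_on_Suc_imp)
qed

lemma smooth_on_partial_deriv: "smooth_on S f \<Longrightarrow> smooth_on S (partial_deriv i f)"
  unfolding smooth_on_def partial_deriv_def[abs_def] by (metis Ck_on.simps(2))

lemma smooth_on_continuous: "smooth_on S f \<Longrightarrow> continuous_on S f"
  unfolding smooth_on_def by (metis Ck_on.simps(1))

lemma smooth_on_has_derivative:
  "smooth_on S f \<Longrightarrow> x \<in> S \<Longrightarrow> (f has_derivative frechet_derivative f (at x)) (at x)"
  using smooth_on_differentiable frechet_derivative_works by blast

lemmas smooth_intros = smooth_on_const smooth_on_add smooth_on_mult smooth_on_diff smooth_on_sum
  smooth_on_nth smooth_on_partial_deriv

lemma frechet_derivative_partial_deriv: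
  assumes "f differentiable (at x)"
  shows "frechet_derivative f (at x) v = (\<Sum>k\<in>UNIV. v $ k * partial_deriv k f x)"
proof -
  have lin: "linear (frechet_derivative f (at x))"
    using assms linear_frechet_derivative by blast
  have "frechet_derivative f (at x) v = frechet_derivative f (at x) (\<Sum>k\<in>UNIV. v $ k *\<^sub>R axis k 1)"
    using basis_expansion[of v] by (simp add: scalar_mult_eq_scaleR)
  also have "\<dots> = (\<Sum>k\<in>UNIV. v $ k * partial_deriv k f x)"
    using lin by (simp add: linear_sum linear_scale partial_deriv_def)
  finally show ?thesis .
qed

lemma partial_deriv_eqI:
  "(f has_derivative D) (at x) \<Longrightarrow> partial_deriv i f x = D (axis i 1)"
  unfolding partial_deriv_def using frechet_derivative_at by metis

lemma partial_deriv_cong: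
  assumes "open S" "x \<in> S" "\<And>y. y \<in> S \<Longrightarrow> f y = g y" "smooth_on S f"
  shows "partial_deriv i f x = partial_deriv i g x"
  unfolding partial_deriv_def
  using frechet_derivative_transform_within_open[OF smooth_on_differentiable[OF assms(4,2)] assms(1-3)] by simp

lemma partial_deriv_const: "partial_deriv i (\<lambda>x. c) x = 0"
  by (simp add: partial_deriv_def)

lemma partial_deriv_add:
  assumes "smooth_on S f" "smooth_on S g" "x \<in> S"
  shows "partial_deriv i (\<lambda>x. f x + g x) x = partial_deriv i f x + partial_deriv i g x"
  using partial_deriv_eqI[OF has_derivative_add[OF smooth_on_has_derivative[OF assms(1,3)] smooth_on_has_derivative[OF assms(2,3)]]]
  by (simp add: partial_deriv_def)

lemma partial_deriv_mult:
  assumes "smooth_on S f" "smooth_on S g" "x \<in> S"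
  shows "partial_deriv i (\<lambda>x. f x * g x) x = f x * partial_deriv i g x + partial_deriv i f x * g x"
  using partial_deriv_eqI[OF has_derivative_mult[OF smooth_on_has_derivative[OF assms(1,3)] smooth_on_has_derivative[OF assms(2,3)]]]
  by (simp add: partial_deriv_def)

lemma partial_deriv_cmult:
  assumes "smooth_on S f" "x \<in> S"
  shows "partial_deriv i (\<lambda>x. c * f x) x = c * partial_deriv i f x"
  using partial_deriv_mult[OF smooth_on_const assms(1,2), of i c] by (simp add: partial_deriv_const)

lemma partial_deriv_sum:
  assumes "\<And>j. j \<in> I \<Longrightarrow> smooth_on S (f j)" "x \<in> S"
  shows "partial_deriv i (\<lambda>x. \<Sum>j\<in>I. f j x) x = (\<Sum>j\<in>I. partial_deriv i (f j) x)"
  using partial_deriv_eqI[OF has_derivative_sum[OF smooth_on_has_derivative[OF assms(1,2)]]]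
  by (simp add: partial_deriv_def)

section \<open>Derivatives along lines and symmetry of second derivatives\<close>

lemma has_real_derivative_along_line:
  assumes "smooth_on S f" "x + t *\<^sub>R v \<in> S"
  shows "((\<lambda>t. f (x + t *\<^sub>R v)) has_real_derivative (\<Sum>k\<in>UNIV. v $ k * partial_deriv k f (x + t *\<^sub>R v))) (at t)"
proof -
  have "((\<lambda>t. x + t *\<^sub>R v) has_derivative (\<lambda>h. h *\<^sub>R v)) (at t)"
    by (auto intro!: derivative_eq_intros)
  from has_derivative_compose[OF this smooth_on_has_derivative[OF assms]]
  have "((\<lambda>t. f (x + t *\<^sub>R v)) has_derivative (\<lambda>h. frechet_derivative f (at (x + t *\<^sub>R v)) (h *\<^sub>R v))) (at t)"
    by simp
  moreover have "frechet_derivative f (at (x + t *\<^sub>R v)) (h *\<^sub>R v) = (\<Sum>k\<in>UNIV. v $ k * partial_deriv k f (x + t *\<^sub>R v)) * h" for h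
    by (simp add: frechet_derivative_partial_deriv[OF smooth_on_differentiable[OF assms]]
        sum_distrib_right sum_distrib_left mult_ac)
  ultimately show ?thesis by (simp add: has_field_derivative_def)
qed

lemma has_real_derivative_along_axis:
  assumes "smooth_on S f" "x + t *\<^sub>R axis i 1 \<in> S"
  shows "((\<lambda>t. f (x + t *\<^sub>R axis i 1)) has_real_derivative partial_deriv i f (x + t *\<^sub>R axis i 1)) (at t)"
proof -
  have "(\<Sum>k\<in>UNIV. axis i 1 $ k * partial_deriv k f y) = partial_deriv i f y" for y
    by (simp add: axis_def if_distrib[of "\<lambda>c. c * _"] cong: if_cong)
  then show ?thesis using has_real_derivative_along_line[OF assms] by simp
qed

text \<open>
  The mean value theorem, used once in direction \<open>i\<close> and then in direction \<open>j\<close>. The left-hand side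
  is symmetric in \<open>i\<close> and \<open>j\<close> while the right-hand side is not, which is what makes the two mixed
  derivatives comparable.
\<close>

lemma mixed_difference_mvt:
  fixes f :: "real ^ 'n::finite \<Rightarrow> real"
  assumes f: "smooth_on S f" and h: "h > 0"
    and sub: "\<And>s t. s \<in> {0..h} \<Longrightarrow> t \<in> {0..h} \<Longrightarrow> x + s *\<^sub>R axis i 1 + t *\<^sub>R axis j 1 \<in> S"
  shows "\<exists>s\<in>{0..h}. \<exists>t\<in>{0..h}.
    f (x + h *\<^sub>R axis i 1 + h *\<^sub>R axis j 1) - f (x + h *\<^sub>R axis i 1) - f (x + h *\<^sub>R axis j 1) + f x
      = h * h * partial_deriv j (partial_deriv i f) (x + s *\<^sub>R axis i 1 + t *\<^sub>R axis j 1)"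
proof -
  let ?i = "axis i 1 :: real ^ 'n" and ?j = "axis j 1 :: real ^ 'n"
  have comm: "x + s *\<^sub>R ?i + t *\<^sub>R ?j = (x + t *\<^sub>R ?j) + s *\<^sub>R ?i" for s t
    by (simp add: algebra_simps)
  define \<phi> where "\<phi> s = f ((x + h *\<^sub>R ?j) + s *\<^sub>R ?i) - f (x + s *\<^sub>R ?i)" for s
  have "\<exists>s. 0 < s \<and> s < h \<and> \<phi> h - \<phi> 0 = (h - 0) * (partial_deriv i f ((x + h *\<^sub>R ?j) + s *\<^sub>R ?i) - partial_deriv i f (x + s *\<^sub>R ?i))"
  proof (rule MVT2[OF h])
    fix s assume s: "0 \<le> s" "s \<le> h"
    have "(x + h *\<^sub>R ?j) + s *\<^sub>R ?i \<in> S" "x + s *\<^sub>R ?i \<in> S"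
      using sub[of s h] sub[of s 0] s h by (auto simp: comm)
    then show "(\<phi> has_real_derivative (partial_deriv i f ((x + h *\<^sub>R ?j) + s *\<^sub>R ?i) - partial_deriv i f (x + s *\<^sub>R ?i))) (at s)"
      unfolding \<phi>_def[abs_def] by (intro DERIV_diff has_real_derivative_along_axis[OF f])
  qed
  then obtain s where s: "0 < s" "s < h"
    "\<phi> h - \<phi> 0 = h * (partial_deriv i f ((x + s *\<^sub>R ?i) + h *\<^sub>R ?j) - partial_deriv i f (x + s *\<^sub>R ?i))"
    by (auto simp: comm)
  have "\<exists>t. 0 < t \<and> t < h \<and> partial_deriv i f ((x + s *\<^sub>R ?i) + h *\<^sub>R ?j) - partial_deriv i f ((x + s *\<^sub>R ?i) + 0 *\<^sub>R ?j)
     = (h - 0) * partial_deriv j (partial_deriv i f) ((x + s *\<^sub>R ?i) + t *\<^sub>R ?j)"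
    by (rule MVT2[OF h]) (use sub s in \<open>auto intro!: has_real_derivative_along_axis[OF smooth_on_partial_deriv[OF f]]\<close>)
  then obtain t where "0 < t" "t < h" "partial_deriv i f ((x + s *\<^sub>R ?i) + h *\<^sub>R ?j) - partial_deriv i f (x + s *\<^sub>R ?i)
     = h * partial_deriv j (partial_deriv i f) ((x + s *\<^sub>R ?i) + t *\<^sub>R ?j)"
    by auto
  then show ?thesis using s
    by (intro bexI[of _ s] bexI[of _ t]) (auto simp: \<phi>_def comm[of h h])
qed

text \<open>
  Schwarz's theorem: the mixed second difference on a small square is the value of either mixed
  derivative at some point of the square, and both derivatives are continuous.
\<close>

lemma partial_deriv_commute:
  fixes f :: "real ^ 'n::finite \<Rightarrow> real"
  assumes S: "open S" "x \<in> S" and f: "smooth_on S f"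
  shows "partial_deriv i (partial_deriv j f) x = partial_deriv j (partial_deriv i f) x"
proof -
  let ?P = "partial_deriv i (partial_deriv j f)" and ?Q = "partial_deriv j (partial_deriv i f)"
  let ?i = "axis i 1 :: real ^ 'n" and ?j = "axis j 1 :: real ^ 'n"
  have cont: "isCont ?P x" "isCont ?Q x"
    using S f by (auto intro!: continuous_on_interior smooth_on_continuous smooth_on_partial_deriv
        simp: interior_open continuous_on_eq_continuous_at[symmetric])
  have "\<bar>?P x - ?Q x\<bar> \<le> e" if "e > 0" for e
  proof -
    obtain r1 where r1: "r1 > 0" "ball x r1 \<subseteq> S" using S open_contains_ball by blast
    obtain r2 where r2: "r2 > 0" "\<And>y. dist y x < r2 \<Longrightarrow> dist (?P y) (?P x) < e/2"
      using cont(1) \<open>e > 0\<close> unfolding continuous_at_eps_delta by (metis half_gt_zero)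
    obtain r3 where r3: "r3 > 0" "\<And>y. dist y x < r3 \<Longrightarrow> dist (?Q y) (?Q x) < e/2"
      using cont(2) \<open>e > 0\<close> unfolding continuous_at_eps_delta by (metis half_gt_zero)
    define r where "r = min r1 (min r2 r3)"
    define h where "h = r / 3"
    have r: "r > 0" and h: "h > 0" using r1 r2 r3 by (auto simp: r_def h_def)
    have near: "dist (x + s *\<^sub>R axis k 1 + t *\<^sub>R axis l 1) x < r"
      if "s \<in> {0..h}" "t \<in> {0..h}" for s t and k l :: 'n
    proof -
      have "norm (s *\<^sub>R axis k 1 + t *\<^sub>R axis l 1 :: real ^ 'n) \<le> \<bar>s\<bar> + \<bar>t\<bar>"
        by (rule order.trans[OF norm_triangle_ineq]) simp
      also have "\<dots> < r" using that r by (auto simp: h_def)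
      finally show ?thesis by (simp add: dist_norm add.assoc)
    qed
    have sub: "x + s *\<^sub>R axis k 1 + t *\<^sub>R axis l 1 \<in> S" if "s \<in> {0..h}" "t \<in> {0..h}" for s t and k l :: 'n
      using near[OF that, of k l] r1 by (auto simp: r_def dist_commute)
    obtain s t where st: "s \<in> {0..h}" "t \<in> {0..h}"
      "f (x + h *\<^sub>R ?i + h *\<^sub>R ?j) - f (x + h *\<^sub>R ?i) - f (x + h *\<^sub>R ?j) + f x = h * h * ?Q (x + s *\<^sub>R ?i + t *\<^sub>R ?j)"
      using mixed_difference_mvt[OF f h sub] by metis
    obtain s' t' where st': "s' \<in> {0..h}" "t' \<in> {0..h}"
      "f (x + h *\<^sub>R ?j + h *\<^sub>R ?i) - f (x + h *\<^sub>R ?j) - f (x + h *\<^sub>R ?i) + f x = h * h * ?P (x + s' *\<^sub>R ?j + t' *\<^sub>R ?i)"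
      using mixed_difference_mvt[OF f h sub] by metis
    have "h * h * ?Q (x + s *\<^sub>R ?i + t *\<^sub>R ?j) = h * h * ?P (x + s' *\<^sub>R ?j + t' *\<^sub>R ?i)"
      unfolding st(3)[symmetric] st'(3)[symmetric] by (simp add: algebra_simps)
    then have "?Q (x + s *\<^sub>R ?i + t *\<^sub>R ?j) = ?P (x + s' *\<^sub>R ?j + t' *\<^sub>R ?i)" using h by simp
    moreover have "dist (?Q (x + s *\<^sub>R ?i + t *\<^sub>R ?j)) (?Q x) < e/2"
      using near[OF st(1,2), of i j] by (intro r3(2)) (simp add: r_def)
    moreover have "dist (?P (x + s' *\<^sub>R ?j + t' *\<^sub>R ?i)) (?P x) < e/2"
      using near[OF st'(1,2), of j i] by (intro r2(2)) (simp add: r_def)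
    ultimately show ?thesis unfolding dist_real_def by linarith
  qed
  then show ?thesis using field_le_epsilon[of "\<bar>?P x - ?Q x\<bar>" 0] by simp
qed

section \<open>Quadratic forms and the second derivative test\<close>

lemma quadratic_form_shift:
  fixes a :: "'n::finite \<Rightarrow> 'n \<Rightarrow> real"
  assumes sym: "\<And>i j. a i j = a j i"
  shows "(\<Sum>i\<in>UNIV. \<Sum>j\<in>UNIV. a i j * (v i + (if i = k then t else 0)) * (v j + (if j = k then t else 0)))
    = (\<Sum>i\<in>UNIV. \<Sum>j\<in>UNIV. a i j * v i * v j) + 2 * t * (\<Sum>i\<in>UNIV. a k i * v i) + t\<^sup>2 * a k k"
proof -
  let ?d = "\<lambda>i. if i = k then t else 0 :: real"
  have inner: "(\<Sum>j\<in>UNIV. a i j * (v i + ?d i) * (v j + ?d j))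
      = (\<Sum>j\<in>UNIV. a i j * v i * v j) + ?d i * (\<Sum>j\<in>UNIV. a i j * v j) + t * (a k i * v i) + ?d i * (t * a k i)" for i
  proof -
    have "a i j * (v i + ?d i) * (v j + ?d j)
      = a i j * v i * v j + ?d i * (a i j * v j) + (if j = k then t * (a k i * v i) + ?d i * (t * a k i) else 0)" for j
      using sym[of i j] by (simp add: algebra_simps)
    then show ?thesis by (simp add: sum.distrib sum_distrib_left)
  qed
  have d: "(\<Sum>i\<in>UNIV. ?d i * c i) = t * c k" for c
    by (simp add: if_distribR if_distrib[of "\<lambda>x. x * _"] cong: if_cong)
  show ?thesis
    unfolding inner sum.distrib d sum_distrib_left[symmetric]
    by (simp add: power2_eq_square)
qed

text \<open>
  Splitting off the
  Schur complement of one diagonal entry at a time, \<open>a\<close> becomes a sum of rank-one matrices, and a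
  rank-one summand contributes a value of the quadratic form of \<open>h\<close>. The induction runs over the
  set of rows that may still be nonzero.
\<close>

lemma trace_mult_psd_nonneg:
  fixes a h :: "'n::finite \<Rightarrow> 'n \<Rightarrow> real"
  assumes "\<And>i j. a i j = a j i"
    and "\<And>v. (\<Sum>i\<in>UNIV. \<Sum>j\<in>UNIV. a i j * v i * v j) \<ge> 0"
    and h: "\<And>v. (\<Sum>i\<in>UNIV. \<Sum>j\<in>UNIV. h i j * v i * v j) \<ge> 0"
  shows "(\<Sum>i\<in>UNIV. \<Sum>j\<in>UNIV. a i j * h i j) \<ge> 0"
proof -
  have "(\<Sum>i\<in>UNIV. \<Sum>j\<in>UNIV. a i j * h i j) \<ge> 0"
    if "finite I" and sym: "\<And>i j. a i j = a j i"
      and psd: "\<And>v. (\<Sum>i\<in>UNIV. \<Sum>j\<in>UNIV. a i j * v i * v j) \<ge> 0"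
      and supp: "\<And>i j. i \<notin> I \<Longrightarrow> a i j = 0" for I and a :: "'n \<Rightarrow> 'n \<Rightarrow> real"
    using that
  proof (induction I arbitrary: a rule: finite_induct)
    case empty
    then show ?case by simp
  next
    case (insert k I)
    note sym = insert.prems(1) and psd = insert.prems(2) and supp = insert.prems(3)
    have shift: "(\<Sum>i\<in>UNIV. \<Sum>j\<in>UNIV. a i j * v i * v j) + 2 * t * (\<Sum>i\<in>UNIV. a k i * v i) + t\<^sup>2 * a k k \<ge> 0" for v t
      using psd[of "\<lambda>i. v i + (if i = k then t else 0)"] quadratic_form_shift[where a = a and v = v and k = k and t = t, OF sym] by simp
    have diag: "a k k \<ge> 0" using shift[of "\<lambda>_. 0" 1] by simp
    show ?case
    proof (cases "a k k = 0")
      case True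
      \<comment> \<open>A vanishing diagonal entry of a semidefinite matrix forces its whole row to vanish.\<close>
      have zero: "a k j = 0" for j
      proof (rule ccontr)
        assume nz: "a k j \<noteq> 0"
        let ?e = "\<lambda>i. if i = j then 1 else 0 :: real"
        have "a i m * ?e i * ?e m = (if i = j then if m = j then a j j else 0 else 0)"
          and "a k i * ?e i = (if i = j then a k j else 0)" for i m by auto
        moreover have "(\<Sum>m\<in>UNIV. if i = j then if m = j then c else 0 else 0) = (if i = j then c else 0)" for i and c :: real
          by simp
        ultimately have "a j j + 2 * t * a k j \<ge> 0" for t
          using shift[of ?e t] True by (simp only: sum.delta finite UNIV_I if_True)
        from this[of "- (a j j + 1) / (2 * a k j)"] show False using nz by (simp add: field_simps)
      qed
      show ?thesis
      proof (rule insert.IH)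
        show "a i j = 0" if "i \<notin> I" for i j using zero supp that by (cases "i = k") auto
      qed (rule sym, rule psd)
    next
      case False
      then have pos: "a k k > 0" using diag by simp
      \<comment> \<open>Schur complement: subtracting the rank-one part clears row and column k.\<close>
      define a' where "a' i j = a i j - a i k * a j k / a k k" for i j
      have "(\<Sum>i\<in>UNIV. \<Sum>j\<in>UNIV. a' i j * h i j) \<ge> 0"
      proof (rule insert.IH)
        show "a' i j = a' j i" for i j unfolding a'_def by (simp only: sym[of i j] mult.commute)
        show "a' i j = 0" if "i \<notin> I" for i j
          using supp[OF _ , of i] that pos by (cases "i = k") (simp_all add: a'_def sym[of j])
        fix v :: "'n \<Rightarrow> real"
        let ?s = "\<Sum>i\<in>UNIV. a k i * v i"
        have "?s = (\<Sum>i\<in>UNIV. a i k * v i)"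
          by (intro sum.cong refl arg_cong2[of _ _ _ _ "(*)"] sym)
        then have square: "(\<Sum>i\<in>UNIV. \<Sum>j\<in>UNIV. (a i k * v i) * (a j k * v j) / a k k) = ?s * ?s / a k k"
          by (simp only: sum_product sum_divide_distrib)
        have "(\<Sum>i\<in>UNIV. \<Sum>j\<in>UNIV. a' i j * v i * v j)
            = (\<Sum>i\<in>UNIV. \<Sum>j\<in>UNIV. a i j * v i * v j - (a i k * v i) * (a j k * v j) / a k k)"
          by (intro sum.cong refl) (simp add: a'_def left_diff_distrib)
        also have "\<dots> = (\<Sum>i\<in>UNIV. \<Sum>j\<in>UNIV. a i j * v i * v j) - ?s * ?s / a k k"
          by (simp only: sum_subtractf square)
        also have "\<dots> = (\<Sum>i\<in>UNIV. \<Sum>j\<in>UNIV. a i j * v i * v j) + 2 * (- ?s / a k k) * ?s + (- ?s / a k k)\<^sup>2 * a k k"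
          using pos by (simp add: power2_eq_square)
        also have "\<dots> \<ge> 0" by (rule shift)
        finally show "(\<Sum>i\<in>UNIV. \<Sum>j\<in>UNIV. a' i j * v i * v j) \<ge> 0" .
      qed
      moreover have "(\<Sum>i\<in>UNIV. \<Sum>j\<in>UNIV. h i j * a i k * a j k) / a k k \<ge> 0"
        using h[of "\<lambda>i. a i k"] pos by simp
      moreover have "(\<Sum>i\<in>UNIV. \<Sum>j\<in>UNIV. a i j * h i j) =
          (\<Sum>i\<in>UNIV. \<Sum>j\<in>UNIV. a' i j * h i j + h i j * a i k * a j k / a k k)"
        by (intro sum.cong refl) (simp add: a'_def left_diff_distrib)
      then have "(\<Sum>i\<in>UNIV. \<Sum>j\<in>UNIV. a i j * h i j) =
          (\<Sum>i\<in>UNIV. \<Sum>j\<in>UNIV. a' i j * h i j) + (\<Sum>i\<in>UNIV. \<Sum>j\<in>UNIV. h i j * a i k * a j k) / a k k"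
        by (simp only: sum.distrib sum_divide_distrib)
      ultimately show ?thesis by linarith
    qed
  qed
  from this[OF finite assms(1,2), of UNIV] show ?thesis by simp
qed

lemma local_max_derivatives:
  fixes f :: "real ^ 'n::finite \<Rightarrow> real"
  assumes S: "open S" "x \<in> S" and f: "smooth_on S f" and max: "\<And>y. y \<in> S \<Longrightarrow> f y \<le> f x"
  shows "partial_deriv i f x = 0"
    and "(\<Sum>i\<in>UNIV. \<Sum>j\<in>UNIV. partial_deriv i (partial_deriv j f) x * v i * v j) \<le> 0"
proof -
  have near: "\<exists>d>0. \<forall>t. \<bar>t\<bar> < d \<longrightarrow> x + t *\<^sub>R w \<in> S" for w
  proof -
    have "open ((\<lambda>t. x + t *\<^sub>R w) -` S)" by (intro open_vimage S(1) continuous_intros)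
    moreover have "0 \<in> (\<lambda>t. x + t *\<^sub>R w) -` S" using S by simp
    ultimately obtain d where "d > 0" "\<forall>t. dist t 0 < d \<longrightarrow> t \<in> (\<lambda>t. x + t *\<^sub>R w) -` S"
      unfolding open_dist by blast
    then show ?thesis by auto
  qed
  have zero: "partial_deriv i f x = 0" for i
  proof -
    obtain d where "d > 0" "\<And>t. \<bar>t\<bar> < d \<Longrightarrow> x + t *\<^sub>R axis i 1 \<in> S" using near by metis
    then show ?thesis
      using DERIV_local_max[of "\<lambda>t. f (x + t *\<^sub>R axis i 1)" "partial_deriv i f x" 0 d]
        has_real_derivative_along_axis[OF f, of x 0 i] S max by simp
  qed
  then show "partial_deriv i f x = 0" .
  define w where "w = (\<chi> i. v i)"
  define g where "g y = (\<Sum>k\<in>UNIV. w $ k * partial_deriv k f y)" for y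
  have g: "smooth_on S g" unfolding g_def[abs_def] by (intro smooth_intros S f)
  obtain d where d: "d > 0" "\<And>t. \<bar>t\<bar> < d \<Longrightarrow> x + t *\<^sub>R w \<in> S" using near by metis
  let ?H = "\<Sum>i\<in>UNIV. \<Sum>j\<in>UNIV. partial_deriv i (partial_deriv j f) x * v i * v j"
  have "partial_deriv k g x = (\<Sum>j\<in>UNIV. v j * partial_deriv k (partial_deriv j f) x)" for k
    unfolding g_def[abs_def] w_def
    using partial_deriv_sum[OF _ S(2), of UNIV "\<lambda>j y. v j * partial_deriv j f y" k]
    by (simp add: partial_deriv_cmult[OF smooth_on_partial_deriv[OF f] S(2)] smooth_intros S f)
  then have g': "((\<lambda>t. g (x + t *\<^sub>R w)) has_real_derivative ?H) (at 0)"
    using has_real_derivative_along_line[OF g, of x 0 w] S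
    by (simp add: w_def sum_distrib_left mult_ac)
  show "?H \<le> 0"
  proof (rule ccontr)
    assume "\<not> ?H \<le> 0"
    then obtain d' where d': "d' > 0" "\<And>t. 0 < t \<Longrightarrow> t < d' \<Longrightarrow> g (x + t *\<^sub>R w) > g x"
      using has_real_derivative_pos_inc_right[OF g'] by auto
    define h where "h = min d d' / 2"
    have h: "0 < h" "h < d" "h < d'" using d d' by (auto simp: h_def)
    have "\<exists>t. 0 < t \<and> t < h \<and> f (x + h *\<^sub>R w) - f (x + 0 *\<^sub>R w) = (h - 0) * g (x + t *\<^sub>R w)"
      unfolding g_def by (rule MVT2[OF h(1)], rule has_real_derivative_along_line[OF f]) (use d h in auto)
    then obtain t where "0 < t" "t < h" "f (x + h *\<^sub>R w) - f x = h * g (x + t *\<^sub>R w)" by auto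
    moreover have "g x = 0" by (simp add: g_def zero)
    ultimately have "f (x + h *\<^sub>R w) > f x" using d'(2)[of t] h by (simp add: algebra_simps)
    then show False using max[of "x + h *\<^sub>R w"] d h by auto
  qed
qed

section \<open>Second-order operators\<close>

definition second_order_op ::
    "('n::finite \<Rightarrow> 'n \<Rightarrow> real ^ 'n \<Rightarrow> real) \<Rightarrow> ('n \<Rightarrow> real ^ 'n \<Rightarrow> real) \<Rightarrow> (real ^ 'n \<Rightarrow> real) \<Rightarrow> real ^ 'n \<Rightarrow> real" where
  "second_order_op a b f x =
     (\<Sum>i\<in>UNIV. \<Sum>j\<in>UNIV. a i j x * partial_deriv i (partial_deriv j f) x) + (\<Sum>i\<in>UNIV. b i x * partial_deriv i f x)"

text \<open>
  For symmetric \<open>a\<close>, half the deviation of the operator from the Leibniz rule. With the inverse metric for \<open>a\<close> it is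
  the inner product of the gradients of \<open>f\<close> and \<open>g\<close>.
\<close>

definition carre_du_champ ::
    "('n::finite \<Rightarrow> 'n \<Rightarrow> real ^ 'n \<Rightarrow> real) \<Rightarrow> (real ^ 'n \<Rightarrow> real) \<Rightarrow> (real ^ 'n \<Rightarrow> real) \<Rightarrow> real ^ 'n \<Rightarrow> real" where
  "carre_du_champ a f g x =
     (\<Sum>i\<in>UNIV. \<Sum>j\<in>UNIV. a i j x * (partial_deriv i f x * partial_deriv j g x))"

text \<open>
  The weak maximum principle at a point. The second-order part is the trace of \<open>a\<close> times the
  negative semidefinite Hessian, and the first-order part vanishes.
\<close>

lemma second_order_op_local_max:
  assumes S: "open S" "x \<in> S" and f: "smooth_on S f" and max: "\<And>y. y \<in> S \<Longrightarrow> f y \<le> f x"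
    and sym: "\<And>i j. a i j x = a j i x"
    and psd: "\<And>v. (\<Sum>i\<in>UNIV. \<Sum>j\<in>UNIV. a i j x * v i * v j) \<ge> 0"
  shows "second_order_op a b f x \<le> 0"
proof -
  have "(\<Sum>i\<in>UNIV. \<Sum>j\<in>UNIV. a i j x * (- partial_deriv i (partial_deriv j f) x)) \<ge> 0"
    using local_max_derivatives(2)[OF S f max]
    by (intro trace_mult_psd_nonneg[OF sym psd]) (simp add: sum_negf)
  then show ?thesis
    using local_max_derivatives(1)[OF S f max] by (simp add: second_order_op_def sum_negf)
qed

lemma second_order_op_add:
  assumes S: "open S" "x \<in> S" and f: "smooth_on S f" and g: "smooth_on S g"
  shows "second_order_op a b (\<lambda>y. f y + g y) x = second_order_op a b f x + second_order_op a b g x"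
proof -
  have "partial_deriv i (partial_deriv j (\<lambda>y. f y + g y)) x
      = partial_deriv i (partial_deriv j f) x + partial_deriv i (partial_deriv j g) x" for i j
  proof -
    have "partial_deriv i (\<lambda>y. partial_deriv j f y + partial_deriv j g y) x = partial_deriv i (partial_deriv j (\<lambda>y. f y + g y)) x"
      by (rule partial_deriv_cong[OF S]) (use f g S in \<open>auto simp: partial_deriv_add intro!: smooth_intros\<close>)
    then show ?thesis
      using partial_deriv_add[OF smooth_on_partial_deriv[OF f] smooth_on_partial_deriv[OF g] S(2)] by simp
  qed
  then show ?thesis
    by (simp add: second_order_op_def partial_deriv_add[OF f g S(2)] distrib_left sum.distrib)
qed

lemma second_order_op_const: "second_order_op a b (\<lambda>y. c) x = 0"
  by (simp add: second_order_op_def partial_deriv_const[abs_def] partial_deriv_const)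

lemma second_order_op_mult:
  assumes S: "open S" "x \<in> S" and f: "smooth_on S f" and g: "smooth_on S g"
    and sym: "\<And>i j. a i j x = a j i x"
  shows "second_order_op a b (\<lambda>y. f y * g y) x
    = f x * second_order_op a b g x + g x * second_order_op a b f x + 2 * carre_du_champ a f g x"
proof -
  have "partial_deriv i (partial_deriv j (\<lambda>y. f y * g y)) x
      = f x * partial_deriv i (partial_deriv j g) x + g x * partial_deriv i (partial_deriv j f) x
        + partial_deriv i f x * partial_deriv j g x + partial_deriv j f x * partial_deriv i g x" for i j
  proof -
    have "partial_deriv i (\<lambda>y. f y * partial_deriv j g y + partial_deriv j f y * g y) x = partial_deriv i (partial_deriv j (\<lambda>y. f y * g y)) x"
      by (rule partial_deriv_cong[OF S]) (use f g S in \<open>auto simp: partial_deriv_mult intro!: smooth_intros\<close>)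
    moreover have "partial_deriv i (\<lambda>y. f y * partial_deriv j g y + partial_deriv j f y * g y) x
      = partial_deriv i (\<lambda>y. f y * partial_deriv j g y) x + partial_deriv i (\<lambda>y. partial_deriv j f y * g y) x"
      by (rule partial_deriv_add[OF _ _ S(2)]) (use f g S in \<open>auto intro!: smooth_intros\<close>)
    ultimately show ?thesis
      using partial_deriv_mult[OF f smooth_on_partial_deriv[OF g] S(2)]
        partial_deriv_mult[OF smooth_on_partial_deriv[OF f] g S(2)] by (simp add: mult_ac)
  qed
  note second = this
  have swap: "(\<Sum>i\<in>UNIV. \<Sum>j\<in>UNIV. a i j x * (partial_deriv j f x * partial_deriv i g x)) = carre_du_champ a f g x"
    unfolding carre_du_champ_def by (subst sum.swap) (simp add: sym)
  have "(\<Sum>i\<in>UNIV. \<Sum>j\<in>UNIV. a i j x * partial_deriv i (partial_deriv j (\<lambda>y. f y * g y)) x)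
    = f x * (\<Sum>i\<in>UNIV. \<Sum>j\<in>UNIV. a i j x * partial_deriv i (partial_deriv j g) x)
      + g x * (\<Sum>i\<in>UNIV. \<Sum>j\<in>UNIV. a i j x * partial_deriv i (partial_deriv j f) x)
      + 2 * carre_du_champ a f g x"
    by (simp add: second distrib_left sum.distrib swap sum_distrib_left carre_du_champ_def[symmetric] mult.left_commute[of _ "f x"] mult.left_commute[of _ "g x"])
  moreover have "(\<Sum>i\<in>UNIV. b i x * partial_deriv i (\<lambda>y. f y * g y) x)
     = f x * (\<Sum>i\<in>UNIV. b i x * partial_deriv i g x) + g x * (\<Sum>i\<in>UNIV. b i x * partial_deriv i f x)"
    by (simp add: partial_deriv_mult[OF f g S(2)] distrib_left sum.distrib sum_distrib_left mult_ac)
  ultimately show ?thesis by (simp add: second_order_op_def algebra_simps)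
qed

lemma second_order_op_cmult:
  assumes S: "open S" "x \<in> S" and f: "smooth_on S f"
  shows "second_order_op a b (\<lambda>y. c * f y) x = c * second_order_op a b f x"
proof -
  have "partial_deriv i (partial_deriv j (\<lambda>y. c * f y)) x = c * partial_deriv i (partial_deriv j f) x" for i j
  proof -
    have "partial_deriv i (\<lambda>y. c * partial_deriv j f y) x = partial_deriv i (partial_deriv j (\<lambda>y. c * f y)) x"
      by (rule partial_deriv_cong[OF S]) (use f S in \<open>auto simp: partial_deriv_cmult intro!: smooth_intros\<close>)
    then show ?thesis using partial_deriv_cmult[OF smooth_on_partial_deriv[OF f] S(2)] by simp
  qed
  then show ?thesis
    by (simp add: second_order_op_def partial_deriv_cmult[OF f S(2)] distrib_left sum_distrib_left mult_ac)
qed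

lemma second_order_op_sum:
  assumes S: "open S" "x \<in> S" and f: "\<And>k. k \<in> I \<Longrightarrow> smooth_on S (f k)"
  shows "second_order_op a b (\<lambda>y. \<Sum>k\<in>I. f k y) x = (\<Sum>k\<in>I. second_order_op a b (f k) x)"
  using f
  by (induction I rule: infinite_finite_induct)
    (auto simp: second_order_op_const second_order_op_add[OF S] smooth_on_sum[OF S(1)])

lemma carre_du_champ_mult_right:
  assumes x: "x \<in> S" and f: "smooth_on S f" and g: "smooth_on S g"
  shows "carre_du_champ a h (\<lambda>y. f y * g y) x = f x * carre_du_champ a h g x + g x * carre_du_champ a h f x"
  by (simp add: carre_du_champ_def partial_deriv_mult[OF f g x] distrib_left sum.distrib sum_distrib_left mult_ac)

text \<open>
  The commutator with a partial derivative contains only second and first derivatives of \<open>u\<close>: the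
  third derivatives agree by symmetry. This is why differentiating the equation costs no more than
  the Hessian terms that ellipticity can absorb.
\<close>

lemma second_order_op_partial_deriv:
  fixes a :: "'n::finite \<Rightarrow> 'n \<Rightarrow> real ^ 'n \<Rightarrow> real"
  assumes S: "open S" "x \<in> S" and u: "smooth_on S u"
    and a: "\<And>i j. smooth_on S (a i j)" and b: "\<And>i. smooth_on S (b i)"
  shows "second_order_op a b (partial_deriv k u) x = partial_deriv k (second_order_op a b u) x
    - ((\<Sum>i\<in>UNIV. \<Sum>j\<in>UNIV. partial_deriv k (a i j) x * partial_deriv i (partial_deriv j u) x)
      + (\<Sum>i\<in>UNIV. partial_deriv k (b i) x * partial_deriv i u x))"
proof -
  have third: "partial_deriv k (partial_deriv i (partial_deriv j u)) x = partial_deriv i (partial_deriv j (partial_deriv k u)) x" for i j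
  proof -
    have "partial_deriv k (partial_deriv i (partial_deriv j u)) x = partial_deriv i (partial_deriv k (partial_deriv j u)) x"
      by (rule partial_deriv_commute[OF S smooth_on_partial_deriv[OF u]])
    also have "\<dots> = partial_deriv i (partial_deriv j (partial_deriv k u)) x"
      by (rule partial_deriv_cong[OF S]) (use u S partial_deriv_commute in \<open>auto intro!: smooth_intros\<close>)
    finally show ?thesis .
  qed
  have "partial_deriv k (second_order_op a b u) x =
      partial_deriv k (\<lambda>y. \<Sum>i\<in>UNIV. \<Sum>j\<in>UNIV. a i j y * partial_deriv i (partial_deriv j u) y) x
      + partial_deriv k (\<lambda>y. \<Sum>i\<in>UNIV. b i y * partial_deriv i u y) x"
    unfolding second_order_op_def[abs_def]
    by (rule partial_deriv_add[OF _ _ S(2)]) (intro smooth_intros S u a b)+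
  also have "partial_deriv k (\<lambda>y. \<Sum>i\<in>UNIV. b i y * partial_deriv i u y) x
      = (\<Sum>i\<in>UNIV. partial_deriv k (\<lambda>y. b i y * partial_deriv i u y) x)"
    by (rule partial_deriv_sum[OF _ S(2)]) (intro smooth_intros S u b)
  also have "partial_deriv k (\<lambda>y. \<Sum>i\<in>UNIV. \<Sum>j\<in>UNIV. a i j y * partial_deriv i (partial_deriv j u) y) x
      = (\<Sum>i\<in>UNIV. partial_deriv k (\<lambda>y. \<Sum>j\<in>UNIV. a i j y * partial_deriv i (partial_deriv j u) y) x)"
    by (rule partial_deriv_sum[OF _ S(2)]) (intro smooth_intros S u a)
  also have "\<dots> = (\<Sum>i\<in>UNIV. \<Sum>j\<in>UNIV. partial_deriv k (\<lambda>y. a i j y * partial_deriv i (partial_deriv j u) y) x)"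
    by (intro sum.cong refl partial_deriv_sum[OF _ S(2)] smooth_intros S u a)
  finally show ?thesis
    using partial_deriv_commute[OF S u, of k]
    by (simp add: second_order_op_def[of _ _ "partial_deriv k u"] third sum.distrib
        partial_deriv_mult[OF a smooth_on_partial_deriv[OF smooth_on_partial_deriv[OF u]] S(2)]
        partial_deriv_mult[OF b smooth_on_partial_deriv[OF u] S(2)])
qed

lemma sum_swap_pairs:
  "(\<Sum>i\<in>A. \<Sum>j\<in>B. \<Sum>k\<in>C. \<Sum>l\<in>D. f i j k l) = (\<Sum>k\<in>C. \<Sum>l\<in>D. \<Sum>i\<in>A. \<Sum>j\<in>B. f i j k l)"
  for f :: "_ \<Rightarrow> _ \<Rightarrow> _ \<Rightarrow> _ \<Rightarrow> 'a::comm_monoid_add"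
proof -
  have "(\<Sum>i\<in>A. \<Sum>j\<in>B. \<Sum>k\<in>C. \<Sum>l\<in>D. f i j k l) = (\<Sum>i\<in>A. \<Sum>k\<in>C. \<Sum>l\<in>D. \<Sum>j\<in>B. f i j k l)"
    by (intro sum.cong refl) (subst sum.swap, intro sum.cong refl, rule sum.swap)
  also have "\<dots> = (\<Sum>k\<in>C. \<Sum>i\<in>A. \<Sum>l\<in>D. \<Sum>j\<in>B. f i j k l)" by (rule sum.swap)
  also have "\<dots> = (\<Sum>k\<in>C. \<Sum>l\<in>D. \<Sum>i\<in>A. \<Sum>j\<in>B. f i j k l)"
    by (intro sum.cong refl) (rule sum.swap)
  finally show ?thesis .
qed

lemma mult_sum_sum:
  fixes c :: "'a::comm_semiring_0"
  shows "c * sum f A * sum g B = (\<Sum>i\<in>A. \<Sum>j\<in>B. c * f i * g j)"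
  by (subst mult.assoc, subst sum_product) (simp add: sum_distrib_left mult.assoc)

text \<open>
  The quadratic gain of the Bernstein argument: ellipticity is used once for the indices \<open>k, l\<close> and
  once for \<open>i, j\<close>. The first use says that the matrix \<open>B\<close> below is positive semidefinite, and then its
  trace against \<open>a\<close> is nonnegative.
\<close>

lemma elliptic_hessian_coercive:
  fixes a h :: "'n::finite \<Rightarrow> 'n \<Rightarrow> real"
  assumes sym: "\<And>i j. a i j = a j i" and c: "c > 0"
    and ell: "\<And>v. c * (\<Sum>i\<in>UNIV. (v i)\<^sup>2) \<le> (\<Sum>i\<in>UNIV. \<Sum>j\<in>UNIV. a i j * v i * v j)"
  shows "c\<^sup>2 * (\<Sum>i\<in>UNIV. \<Sum>k\<in>UNIV. (h i k)\<^sup>2)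
    \<le> (\<Sum>k\<in>UNIV. \<Sum>l\<in>UNIV. a k l * (\<Sum>i\<in>UNIV. \<Sum>j\<in>UNIV. a i j * (h i k * h j l)))"
proof -
  have psd: "(\<Sum>i\<in>UNIV. \<Sum>j\<in>UNIV. a i j * v i * v j) \<ge> 0" for v
    by (rule order.trans[OF _ ell]) (use c in \<open>simp add: sum_nonneg\<close>)
  define B where "B i j = (\<Sum>k\<in>UNIV. \<Sum>l\<in>UNIV. a k l * h i k * h j l) - c * (\<Sum>k\<in>UNIV. h i k * h j k)" for i j
  have "(\<Sum>i\<in>UNIV. \<Sum>j\<in>UNIV. B i j * v i * v j) \<ge> 0" for v
  proof -
    define w where "w k = (\<Sum>i\<in>UNIV. v i * h i k)" for k
    have "(\<Sum>i\<in>UNIV. \<Sum>j\<in>UNIV. (\<Sum>k\<in>UNIV. \<Sum>l\<in>UNIV. a k l * h i k * h j l) * v i * v j)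
        = (\<Sum>i\<in>UNIV. \<Sum>j\<in>UNIV. \<Sum>k\<in>UNIV. \<Sum>l\<in>UNIV. a k l * (v i * h i k) * (v j * h j l))"
      by (intro sum.cong refl) (simp add: sum_distrib_left mult_ac)
    also have "\<dots> = (\<Sum>k\<in>UNIV. \<Sum>l\<in>UNIV. \<Sum>i\<in>UNIV. \<Sum>j\<in>UNIV. a k l * (v i * h i k) * (v j * h j l))"
      by (rule sum_swap_pairs)
    also have "\<dots> = (\<Sum>k\<in>UNIV. \<Sum>l\<in>UNIV. a k l * w k * w l)"
      unfolding w_def mult_sum_sum ..
    finally have 1: "(\<Sum>i\<in>UNIV. \<Sum>j\<in>UNIV. (\<Sum>k\<in>UNIV. \<Sum>l\<in>UNIV. a k l * h i k * h j l) * v i * v j) = \<dots>" .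
    \<comment> \<open>A dummy sum over one point makes this an instance of the four-fold exchange of sums.\<close>
    have "(\<Sum>i\<in>UNIV. \<Sum>j\<in>UNIV. (\<Sum>k\<in>UNIV. h i k * h j k) * v i * v j)
       = (\<Sum>i\<in>UNIV. \<Sum>j\<in>UNIV. \<Sum>k\<in>UNIV. \<Sum>l\<in>{()}. (v i * h i k) * (v j * h j k))"
      by (intro sum.cong refl) (simp add: sum_distrib_left mult_ac)
    also have "\<dots> = (\<Sum>k\<in>UNIV. \<Sum>l\<in>{()}. \<Sum>i\<in>UNIV. \<Sum>j\<in>UNIV. (v i * h i k) * (v j * h j k))"
      by (rule sum_swap_pairs)
    also have "\<dots> = (\<Sum>k\<in>UNIV. (w k)\<^sup>2)"
      by (simp add: w_def power2_eq_square sum_product)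
    finally have 2: "(\<Sum>i\<in>UNIV. \<Sum>j\<in>UNIV. (\<Sum>k\<in>UNIV. h i k * h j k) * v i * v j) = \<dots>" .
    have "(\<Sum>i\<in>UNIV. \<Sum>j\<in>UNIV. B i j * v i * v j)
        = (\<Sum>k\<in>UNIV. \<Sum>l\<in>UNIV. a k l * w k * w l) - c * (\<Sum>k\<in>UNIV. (w k)\<^sup>2)"
      unfolding 1[symmetric] 2[symmetric]
      by (simp only: B_def left_diff_distrib sum_subtractf mult.assoc[of c] sum_distrib_left[of c, symmetric])
    then show ?thesis using ell[of w] by simp
  qed
  then have "(\<Sum>i\<in>UNIV. \<Sum>j\<in>UNIV. a i j * B i j) \<ge> 0"
    by (rule trace_mult_psd_nonneg[OF sym psd])
  moreover have "(\<Sum>i\<in>UNIV. \<Sum>j\<in>UNIV. a i j * (\<Sum>k\<in>UNIV. \<Sum>l\<in>UNIV. a k l * h i k * h j l))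
      = (\<Sum>k\<in>UNIV. \<Sum>l\<in>UNIV. a k l * (\<Sum>i\<in>UNIV. \<Sum>j\<in>UNIV. a i j * (h i k * h j l)))"
  proof -
    have "(\<Sum>i\<in>UNIV. \<Sum>j\<in>UNIV. a i j * (\<Sum>k\<in>UNIV. \<Sum>l\<in>UNIV. a k l * h i k * h j l))
      = (\<Sum>i\<in>UNIV. \<Sum>j\<in>UNIV. \<Sum>k\<in>UNIV. \<Sum>l\<in>UNIV. a k l * (a i j * (h i k * h j l)))"
      by (intro sum.cong refl) (simp add: sum_distrib_left mult_ac)
    also have "\<dots> = (\<Sum>k\<in>UNIV. \<Sum>l\<in>UNIV. \<Sum>i\<in>UNIV. \<Sum>j\<in>UNIV. a k l * (a i j * (h i k * h j l)))"
      by (rule sum_swap_pairs)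
    finally show ?thesis by (simp only: sum_distrib_left)
  qed
  moreover have "(\<Sum>i\<in>UNIV. \<Sum>j\<in>UNIV. a i j * (\<Sum>k\<in>UNIV. h i k * h j k))
      = (\<Sum>k\<in>UNIV. \<Sum>i\<in>UNIV. \<Sum>j\<in>UNIV. a i j * h i k * h j k)"
  proof -
    have "(\<Sum>i\<in>UNIV. \<Sum>j\<in>UNIV. a i j * (\<Sum>k\<in>UNIV. h i k * h j k))
      = (\<Sum>i\<in>UNIV. \<Sum>j\<in>UNIV. \<Sum>k\<in>UNIV. \<Sum>l\<in>{()}. a i j * h i k * h j k)"
      by (intro sum.cong refl) (simp add: sum_distrib_left mult_ac)
    also have "\<dots> = (\<Sum>k\<in>UNIV. \<Sum>l\<in>{()}. \<Sum>i\<in>UNIV. \<Sum>j\<in>UNIV. a i j * h i k * h j k)"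
      by (rule sum_swap_pairs)
    finally show ?thesis by simp
  qed
  moreover have "c * (\<Sum>k\<in>UNIV. \<Sum>i\<in>UNIV. (h i k)\<^sup>2) \<le> (\<Sum>k\<in>UNIV. \<Sum>i\<in>UNIV. \<Sum>j\<in>UNIV. a i j * h i k * h j k)"
    by (subst sum_distrib_left) (intro sum_mono ell)
  moreover have "(\<Sum>i\<in>UNIV. \<Sum>j\<in>UNIV. a i j * B i j)
      = (\<Sum>i\<in>UNIV. \<Sum>j\<in>UNIV. a i j * (\<Sum>k\<in>UNIV. \<Sum>l\<in>UNIV. a k l * h i k * h j l))
        - c * (\<Sum>i\<in>UNIV. \<Sum>j\<in>UNIV. a i j * (\<Sum>k\<in>UNIV. h i k * h j k))"
    unfolding B_def right_diff_distrib sum_subtractf mult.left_commute[of _ c] sum_distrib_left[of c, symmetric] ..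
  ultimately have "c * (\<Sum>k\<in>UNIV. \<Sum>i\<in>UNIV. \<Sum>j\<in>UNIV. a i j * h i k * h j k)
     \<le> (\<Sum>k\<in>UNIV. \<Sum>l\<in>UNIV. a k l * (\<Sum>i\<in>UNIV. \<Sum>j\<in>UNIV. a i j * (h i k * h j l)))"
    and "c * (c * (\<Sum>k\<in>UNIV. \<Sum>i\<in>UNIV. (h i k)\<^sup>2)) \<le> c * (\<Sum>k\<in>UNIV. \<Sum>i\<in>UNIV. \<Sum>j\<in>UNIV. a i j * h i k * h j k)"
    using c by simp_all
  moreover have "(\<Sum>i\<in>UNIV. \<Sum>k\<in>UNIV. (h i k)\<^sup>2) = (\<Sum>k\<in>UNIV. \<Sum>i\<in>UNIV. (h i k)\<^sup>2)"
    by (rule sum.swap)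
  ultimately show ?thesis by (simp only: power2_eq_square[of c] mult.assoc)
qed

section \<open>The Bernstein gradient bound\<close>

lemma abs_mult_le: "\<bar>x\<bar> \<le> X \<Longrightarrow> \<bar>y\<bar> \<le> Y \<Longrightarrow> \<bar>x * y\<bar> \<le> X * Y" for x y :: real
  unfolding abs_mult by (rule mult_mono) (auto intro: order.trans[OF abs_ge_zero])

lemma abs_sum_le_card:
  fixes f :: "'n::finite \<Rightarrow> real"
  assumes "\<And>i. \<bar>f i\<bar> \<le> c"
  shows "\<bar>\<Sum>i\<in>UNIV. f i\<bar> \<le> real CARD('n) * c"
  by (rule order.trans[OF sum_abs sum_bounded_above]) (rule assms)

text \<open>
  Here \<open>n\<close> is the dimension, \<open>c\<close> an ellipticity constant and \<open>N\<close> a bound for the coefficients and their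
  derivatives. The number \<open>B\<close> bounds the error terms, and \<open>B\<^sup>2 / (8 * c\<^sup>2)\<close> is the price of absorbing the
  product of Hessian and gradient into the coercive Hessian term.
\<close>

definition bernstein_const :: "real \<Rightarrow> real \<Rightarrow> real \<Rightarrow> real" where
  "bernstein_const n c N = (let B = 6 * n ^ 4 * N\<^sup>2 in 2 + (B + B\<^sup>2 / (8 * c\<^sup>2)) / (2 * c))"

text \<open>
  The arithmetic of the Bernstein argument. At the maximum \<open>G\<close> is the squared gradient length, \<open>v\<close> the
  square of the function, \<open>P\<close> and \<open>Q\<close> the Euclidean sizes of gradient and Hessian, \<open>T\<close> the coercive Hessian
  term and \<open>E\<close> the error. Because \<open>\<mu> \<ge> 1\<close>, a multiple of \<open>G\<close> is dominated by the term \<open>A * \<mu> * G\<close> for large \<open>A\<close>.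
\<close>

lemma bernstein_absorption:
  fixes A B G P Q T E \<mu> c v :: real
  assumes c: "c > 0" and B: "B \<ge> 0" and \<mu>: "\<mu> \<ge> 1" and A: "A \<ge> 2 + (B + B\<^sup>2 / (8 * c\<^sup>2)) / (2 * c)"
    and max: "- 2 * \<mu> * G + 2 * T + E + A * \<mu> * (- 2 * \<mu> * v + 2 * G) \<le> 0"
    and T: "c\<^sup>2 * Q\<^sup>2 \<le> T" and E: "- (B * (P * Q + P\<^sup>2)) \<le> E" and G: "c * P\<^sup>2 \<le> G"
  shows "G \<le> A * \<mu> * v"
proof -
  define D where "D = (B + B\<^sup>2 / (8 * c\<^sup>2)) / c"
  have D: "D \<ge> 0" using c B by (simp add: D_def)
  have G0: "G \<ge> 0" by (rule order.trans[OF _ G]) (use c in simp)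
  have "B * (P * Q) \<le> 2 * (c\<^sup>2 * Q\<^sup>2) + B\<^sup>2 / (8 * c\<^sup>2) * P\<^sup>2"
  proof -
    have "0 \<le> (4 * c\<^sup>2 * Q - B * P)\<^sup>2 / (8 * c\<^sup>2)" by simp
    also have "\<dots> = 2 * (c\<^sup>2 * Q\<^sup>2) + B\<^sup>2 / (8 * c\<^sup>2) * P\<^sup>2 - B * (P * Q)"
      using c by (simp add: field_simps power2_eq_square)
    finally show ?thesis by simp
  qed
  moreover have "(B + B\<^sup>2 / (8 * c\<^sup>2)) * P\<^sup>2 = D * (c * P\<^sup>2)" using c by (simp add: D_def)
  moreover have "D * (c * P\<^sup>2) \<le> D * G" by (rule mult_left_mono[OF G D])
  ultimately have "- (D * G) \<le> 2 * T + E" using T E by (simp add: algebra_simps)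
  then have "2 * (\<mu> * G) * (A - 1) - D * G \<le> 2 * (A * \<mu> * v) * \<mu>"
    using max by (simp add: algebra_simps)
  moreover have "D * G \<le> D * (\<mu> * G)" using D G0 \<mu> by (simp add: mult_left_mono mult_right_mono[of 1 \<mu> G, simplified])
  moreover have "2 * (\<mu> * G) * (A - 1) \<ge> (\<mu> * G) * (2 + D)"
  proof -
    define X where "X = (B + B\<^sup>2 / (8 * c\<^sup>2)) / (2 * c)"
    have "y / c = 2 * (y / (2 * c))" for y by simp
    then have "D = 2 * X" unfolding D_def X_def .
    then have "2 + D \<le> 2 * (A - 1)" using A[folded X_def] by simp
    from mult_left_mono[OF this, of "\<mu> * G"] show ?thesis using G0 \<mu> by (simp add: mult_ac)
  qed
  ultimately have "G * \<mu> \<le> (A * \<mu> * v) * \<mu>" by (simp add: algebra_simps)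
  then show ?thesis using \<mu> by (simp add: mult_ac)
qed

text \<open>
  Bernstein's method. The auxiliary function is the squared gradient length plus \<open>A * \<mu> * u\<^sup>2\<close>; at its
  maximum the operator applied to it is nonpositive. Expanding with the product rule, the first
  summand yields \<open>- 2 * \<mu>\<close> times the squared gradient plus a coercive Hessian term, and the second
  summand yields \<open>2 * A * \<mu>\<close> times the squared gradient, so for large \<open>A\<close> the gradient is controlled by \<open>u\<close>.
\<close>

lemma bernstein_gradient_bound_at_max:
  fixes a :: "'n::finite \<Rightarrow> 'n \<Rightarrow> real ^ 'n \<Rightarrow> real"
  assumes S: "open S" "x \<in> S" and u: "smooth_on S u"
    and a: "\<And>i j. smooth_on S (a i j)" and b: "\<And>i. smooth_on S (b i)"
    and sym: "\<And>i j. a i j x = a j i x" and c: "c > 0"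
    and ell: "\<And>v. c * (\<Sum>i\<in>UNIV. (v i)\<^sup>2) \<le> (\<Sum>i\<in>UNIV. \<Sum>j\<in>UNIV. a i j x * v i * v j)"
    and N: "\<And>i j. \<bar>a i j x\<bar> \<le> N" "\<And>i j k. \<bar>partial_deriv k (a i j) x\<bar> \<le> N"
      "\<And>i j k l. \<bar>partial_deriv k (partial_deriv l (a i j)) x\<bar> \<le> N"
      "\<And>i. \<bar>b i x\<bar> \<le> N" "\<And>i k. \<bar>partial_deriv k (b i) x\<bar> \<le> N"
    and eq: "\<And>y. y \<in> S \<Longrightarrow> second_order_op a b u y = - \<mu> * u y" and \<mu>: "\<mu> \<ge> 1"
    and A: "A \<ge> bernstein_const (real CARD('n)) c N"
    and max: "\<And>y. y \<in> S \<Longrightarrow> carre_du_champ a u u y + A * \<mu> * (u y)\<^sup>2 \<le> carre_du_champ a u u x + A * \<mu> * (u x)\<^sup>2"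
  shows "carre_du_champ a u u x \<le> A * \<mu> * (u x)\<^sup>2"
proof -
  let ?n = "real CARD('n)" and ?L = "second_order_op a b" and ?\<Gamma> = "carre_du_champ a"
  define U where "U k = partial_deriv k u" for k
  define H where "H i k = partial_deriv i (U k) x" for i k
  define P where "P = sqrt (\<Sum>k\<in>UNIV. (U k x)\<^sup>2)"
  define Q where "Q = sqrt (\<Sum>i\<in>UNIV. \<Sum>k\<in>UNIV. (H i k)\<^sup>2)"
  define B where "B = 6 * ?n ^ 4 * N\<^sup>2"
  define T where "T = (\<Sum>k\<in>UNIV. \<Sum>l\<in>UNIV. a k l x * ?\<Gamma> (U k) (U l) x)"
  have U: "smooth_on S (U k)" for k unfolding U_def by (rule smooth_on_partial_deriv[OF u])
  have P: "\<bar>U k x\<bar> \<le> P" for k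
    unfolding P_def by (rule real_le_rsqrt) (use member_le_sum[of k UNIV "\<lambda>k. (U k x)\<^sup>2"] in simp)
  have Q: "\<bar>H i k\<bar> \<le> Q" for i k
  proof -
    have "(H i k)\<^sup>2 \<le> (\<Sum>k\<in>UNIV. (H i k)\<^sup>2)" by (rule member_le_sum) auto
    also have "\<dots> \<le> (\<Sum>i\<in>UNIV. \<Sum>k\<in>UNIV. (H i k)\<^sup>2)"
      by (rule member_le_sum[of i UNIV "\<lambda>i. \<Sum>k\<in>UNIV. (H i k)\<^sup>2"]) (auto intro: sum_nonneg)
    finally show ?thesis unfolding Q_def by (intro real_le_rsqrt) simp
  qed
  have P2: "P\<^sup>2 = (\<Sum>k\<in>UNIV. (U k x)\<^sup>2)" unfolding P_def by (simp add: sum_nonneg)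
  have Q2: "Q\<^sup>2 = (\<Sum>i\<in>UNIV. \<Sum>k\<in>UNIV. (H i k)\<^sup>2)" unfolding Q_def by (simp add: sum_nonneg)
  have nonneg: "P \<ge> 0" "Q \<ge> 0" "N \<ge> 0"
    using P Q N(4) by (meson abs_ge_zero order.trans)+

  \<comment> \<open>The commutator terms \<open>R k\<close> contain no third derivatives, hence are of order \<open>Q + P\<close>.\<close>
  define R where "R k = (\<Sum>i\<in>UNIV. \<Sum>j\<in>UNIV. partial_deriv k (a i j) x * H i j) + (\<Sum>i\<in>UNIV. partial_deriv k (b i) x * U i x)" for k
  have LU: "?L (U k) x = - \<mu> * U k x - R k" for k
  proof -
    have "partial_deriv k (\<lambda>y. - \<mu> * u y) x = partial_deriv k (?L u) x"
      by (rule partial_deriv_cong[OF S eq[symmetric] smooth_on_mult[OF S(1) smooth_on_const u]])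
    then show ?thesis
      using second_order_op_partial_deriv[OF S u a b, where k = k] partial_deriv_cmult[OF u S(2), where i = k and c = "- \<mu>"]
      by (simp add: U_def[symmetric] H_def[symmetric] R_def)
  qed
  have R: "\<bar>R k\<bar> \<le> ?n * (?n * (N * Q)) + ?n * (N * P)" for k
    unfolding R_def
    by (intro order.trans[OF abs_triangle_ineq] add_mono abs_sum_le_card abs_mult_le N P Q)
  have La: "\<bar>?L (a k l) x\<bar> \<le> ?n * (?n * (N * N)) + ?n * (N * N)" for k l
    unfolding second_order_op_def
    by (intro order.trans[OF abs_triangle_ineq] add_mono abs_sum_le_card abs_mult_le N)
  have \<Gamma>a: "\<bar>?\<Gamma> (a k l) (U m) x\<bar> \<le> ?n * (?n * (N * (N * Q)))" for k l m
    unfolding carre_du_champ_def H_def[symmetric]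
    by (intro abs_sum_le_card abs_mult_le N Q)

  define E where "E k l = (- (a k l x * (U k x * R l + U l x * R k))) + (U k x * U l x) * ?L (a k l) x
      + 2 * (U k x * ?\<Gamma> (a k l) (U l) x + U l x * ?\<Gamma> (a k l) (U k) x)" for k l
  have "\<bar>E k l\<bar> \<le> ?n ^ 2 * (6 * N\<^sup>2 * (P * Q + P\<^sup>2))" for k l
  proof -
    let ?r = "?n * (?n * (N * Q)) + ?n * (N * P)" and ?g = "?n * (?n * (N * (N * Q)))"
    have "\<bar>E k l\<bar> \<le> N * (P * ?r + P * ?r) + P * P * (?n * (?n * (N * N)) + ?n * (N * N)) + 2 * (P * ?g + P * ?g)"
      unfolding E_def
      by (intro order.trans[OF abs_triangle_ineq] add_mono abs_mult_le R La \<Gamma>a P N abs_minus_cancel[THEN eq_refl, THEN order.trans]) simp_all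
    also have "\<dots> = ?n ^ 2 * (6 * N\<^sup>2 * (P * Q)) + (?n ^ 2 + 3 * ?n) * (N\<^sup>2 * P\<^sup>2)"
      by (simp add: algebra_simps power2_eq_square)
    also have "\<dots> \<le> ?n ^ 2 * (6 * N\<^sup>2 * (P * Q)) + (?n ^ 2 * 6) * (N\<^sup>2 * P\<^sup>2)"
    proof -
      have "1 \<le> ?n" using zero_less_card_finite[where 'a = 'n] by linarith
      then have "?n * 1 \<le> ?n * ?n" by (intro mult_left_mono) auto
      then have "?n ^ 2 + 3 * ?n \<le> ?n ^ 2 * 6" by (simp add: power2_eq_square) (use \<open>1 \<le> ?n\<close> in linarith)
      then show ?thesis by (intro add_left_mono mult_right_mono) auto
    qed
    also have "\<dots> = ?n ^ 2 * (6 * N\<^sup>2 * (P * Q + P\<^sup>2))" by (simp add: algebra_simps)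
    finally show ?thesis .
  qed
  then have "\<bar>\<Sum>k\<in>UNIV. \<Sum>l\<in>UNIV. E k l\<bar> \<le> ?n * (?n * (?n ^ 2 * (6 * N\<^sup>2 * (P * Q + P\<^sup>2))))"
    by (intro abs_sum_le_card)
  also have "\<dots> = B * (P * Q + P\<^sup>2)" by (simp add: B_def power2_eq_square power4_eq_xxxx mult_ac)
  finally have E: "- (B * (P * Q + P\<^sup>2)) \<le> (\<Sum>k\<in>UNIV. \<Sum>l\<in>UNIV. E k l)" by linarith

  have product: "?L (\<lambda>y. f y * g y) x = f x * ?L g x + g x * ?L f x + 2 * ?\<Gamma> f g x"
    if "smooth_on S f" "smooth_on S g" for f g
    by (rule second_order_op_mult[OF S that, where a = a, OF sym])
  have L_term: "?L (\<lambda>y. a k l y * (U k y * U l y)) x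
      = - 2 * \<mu> * (a k l x * (U k x * U l x)) + 2 * (a k l x * ?\<Gamma> (U k) (U l) x) + E k l" for k l
    unfolding product[OF a smooth_on_mult[OF S(1) U U]] product[OF U U]
      carre_du_champ_mult_right[OF S(2) U U] LU E_def by (simp add: algebra_simps)
  have \<Gamma>_eq: "?\<Gamma> u u = (\<lambda>y. \<Sum>k\<in>UNIV. \<Sum>l\<in>UNIV. a k l y * (U k y * U l y))"
    by (rule ext) (simp add: carre_du_champ_def U_def)
  have "?L (?\<Gamma> u u) x = (\<Sum>k\<in>UNIV. \<Sum>l\<in>UNIV. ?L (\<lambda>y. a k l y * (U k y * U l y)) x)"
    unfolding \<Gamma>_eq
    by (subst second_order_op_sum[OF S], intro smooth_intros S a U)
      (intro sum.cong refl second_order_op_sum[OF S] smooth_intros S a U)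
  also have "\<dots> = - 2 * \<mu> * ?\<Gamma> u u x + 2 * T + (\<Sum>k\<in>UNIV. \<Sum>l\<in>UNIV. E k l)"
    unfolding L_term \<Gamma>_eq T_def by (simp only: sum.distrib sum_distrib_left)
  finally have L\<Gamma>: "?L (?\<Gamma> u u) x = \<dots>" .
  have Lu2: "?L (\<lambda>y. u y * u y) x = - 2 * \<mu> * (u x)\<^sup>2 + 2 * ?\<Gamma> u u x"
    by (simp add: product u eq[OF S(2)] power2_eq_square)
  have sm: "smooth_on S (?\<Gamma> u u)" unfolding \<Gamma>_eq by (intro smooth_intros S a U)
  have sm2: "smooth_on S (\<lambda>y. A * \<mu> * (u y * u y))" by (intro smooth_intros S u)
  have psd: "(\<Sum>i\<in>UNIV. \<Sum>j\<in>UNIV. a i j x * v i * v j) \<ge> 0" for v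
    by (rule order.trans[OF _ ell]) (use c in \<open>simp add: sum_nonneg\<close>)
  have "?L (\<lambda>y. ?\<Gamma> u u y + A * \<mu> * (u y * u y)) x \<le> 0"
    by (rule second_order_op_local_max[OF S smooth_on_add[OF S(1) sm sm2], where a = a, OF _ sym psd])
      (use max in \<open>simp add: power2_eq_square\<close>)
  then have "- 2 * \<mu> * ?\<Gamma> u u x + 2 * T + (\<Sum>k\<in>UNIV. \<Sum>l\<in>UNIV. E k l) + A * \<mu> * (- 2 * \<mu> * (u x)\<^sup>2 + 2 * ?\<Gamma> u u x) \<le> 0"
    using Lu2 L\<Gamma>
    by (simp only: second_order_op_add[OF S sm sm2] second_order_op_cmult[OF S smooth_on_mult[OF S(1) u u]])
  moreover have "c\<^sup>2 * Q\<^sup>2 \<le> T"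
    unfolding Q2 T_def carre_du_champ_def H_def[symmetric]
    by (rule elliptic_hessian_coercive[OF sym c ell])
  moreover have "c * P\<^sup>2 \<le> ?\<Gamma> u u x"
    using ell[of "\<lambda>k. U k x"] unfolding P2 \<Gamma>_eq by (simp add: mult.assoc)
  moreover have "A \<ge> 2 + (B + B\<^sup>2 / (8 * c\<^sup>2)) / (2 * c)"
    using A by (simp only: bernstein_const_def B_def Let_def)
  ultimately show ?thesis
    by (intro bernstein_absorption[OF c _ \<mu> _ _ _ E]) (simp_all add: B_def)
qed

section \<open>The barrier argument\<close>

lemma gradient_bound_imp_lipschitz:
  fixes u :: "real ^ 'n::finite \<Rightarrow> real"
  assumes C: "convex C" "C \<subseteq> S" and u: "smooth_on S u" and L: "L \<ge> 0"
    and grad: "\<And>y. y \<in> C \<Longrightarrow> (\<Sum>k\<in>UNIV. (partial_deriv k u y)\<^sup>2) \<le> L\<^sup>2"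
    and xy: "x \<in> C" "y \<in> C"
  shows "\<bar>u x - u y\<bar> \<le> L * norm (x - y)"
proof -
  have "norm (u x - u y) \<le> L * norm (x - y)"
  proof (rule differentiable_bound[OF C(1) _ _ xy])
    fix z assume z: "z \<in> C"
    show "(u has_derivative frechet_derivative u (at z)) (at z within C)"
      using smooth_on_has_derivative[OF u] z C(2) has_derivative_at_withinI by blast
    show "onorm (frechet_derivative u (at z)) \<le> L"
    proof (rule onorm_le)
      fix v :: "real ^ 'n"
      define D where "D = (\<chi> k. partial_deriv k u z)"
      have "frechet_derivative u (at z) v = v \<bullet> D"
        using frechet_derivative_partial_deriv[OF smooth_on_differentiable[OF u]] z C(2)
        by (auto simp: D_def inner_vec_def)
      moreover have "norm D \<le> L"
        using grad[OF z] L by (simp add: norm_vec_def L2_set_def D_def real_le_lsqrt sum_nonneg)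
      ultimately show "norm (frechet_derivative u (at z) v) \<le> L * norm v"
        using Cauchy_Schwarz_ineq2[of v D] mult_left_mono[of "norm D" L "norm v"] by (simp add: mult.commute)
    qed
  qed
  then show ?thesis by simp
qed

text \<open>
  The product form of the squares lets the product rule do the computation: each coordinate function
  has constant derivatives.
\<close>

lemma second_order_op_square_dist:
  fixes a :: "'n::finite \<Rightarrow> 'n \<Rightarrow> real ^ 'n \<Rightarrow> real"
  assumes S: "open S" "x \<in> S" and sym: "\<And>i j. a i j x = a j i x"
  shows "second_order_op a b (\<lambda>y. \<Sum>k\<in>UNIV. (y $ k - z $ k) * (y $ k - z $ k)) x
    = (\<Sum>k\<in>UNIV. 2 * ((x $ k - z $ k) * b k x) + 2 * a k k x)"
proof -
  let ?w = "\<lambda>k (y :: real ^ 'n). y $ k - z $ k"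
  have sm: "smooth_on S (?w k)" for k by (intro smooth_intros S)
  have pd: "partial_deriv i (?w k) y = (if i = k then 1 else 0)" for i k y
  proof -
    have "(?w k has_derivative (\<lambda>h. h $ k)) (at y)"
      by (auto intro!: derivative_eq_intros bounded_linear_imp_has_derivative bounded_linear_vec_nth)
    from partial_deriv_eqI[OF this, of i] show ?thesis by (auto simp: axis_def)
  qed
  have "partial_deriv i (partial_deriv j (?w k)) x = 0" for i j k
    unfolding pd[abs_def] by (rule partial_deriv_const)
  then have "second_order_op a b (?w k) x = b k x" for k
    by (simp add: second_order_op_def pd if_distrib[of "\<lambda>t. _ * t"] cong: if_cong)
  moreover have "carre_du_champ a (?w k) (?w k) x = a k k x" for k
  proof -
    have "a i j x * ((if i = k then 1 else 0) * (if j = k then 1 else 0)) = (if i = k then if j = k then a k k x else 0 else 0)" for i j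
      by simp
    moreover have "(\<Sum>j\<in>UNIV. if i = k then if j = k then a k k x else 0 else 0) = (if i = k then a k k x else 0)" for i
      by simp
    ultimately show ?thesis by (simp only: carre_du_champ_def pd sum.delta finite UNIV_I if_True)
  qed
  ultimately have "second_order_op a b (\<lambda>y. ?w k y * ?w k y) x = 2 * (?w k x * b k x) + 2 * a k k x" for k
    by (simp add: second_order_op_mult[OF S sm sm, where a = a, OF sym])
  then show ?thesis
    by (subst second_order_op_sum[OF S smooth_on_mult[OF S(1) sm sm]]) simp
qed

text \<open>
  Work on the ball of radius \<open>r = d / l\<close> about \<open>z\<close>. If \<open>u\<close> drops there by half of \<open>u z\<close>, then its slope is already of
  order \<open>l * u z\<close>. Otherwise the equation makes \<open>u\<close> strictly superharmonic of size \<open>l\<^sup>2 * u z\<close>, so that a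
  small multiple \<open>\<kappa>\<close> of the squared distance can be added with the sum still strictly superharmonic.
  The minimum of the sum is then on the boundary sphere, where \<open>u\<close> must lie below \<open>u z\<close> by
  \<open>\<kappa> * r\<^sup>2\<close>; again the slope is at least of order \<open>l * u z\<close>.
\<close>

lemma barrier_lower_bound:
  fixes a :: "'n::finite \<Rightarrow> 'n \<Rightarrow> real ^ 'n \<Rightarrow> real"
  assumes S: "open S" "cball z d \<subseteq> S" and d: "0 < d" "d \<le> 1" and u: "smooth_on S u"
    and sym: "\<And>i j y. y \<in> cball z d \<Longrightarrow> a i j y = a j i y"
    and psd: "\<And>v y. y \<in> cball z d \<Longrightarrow> (\<Sum>i\<in>UNIV. \<Sum>j\<in>UNIV. a i j y * v i * v j) \<ge> 0"
    and N: "N > 0" "\<And>i j y. y \<in> cball z d \<Longrightarrow> \<bar>a i j y\<bar> \<le> N" "\<And>i y. y \<in> cball z d \<Longrightarrow> \<bar>b i y\<bar> \<le> N"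
    and eq: "\<And>y. y \<in> S \<Longrightarrow> second_order_op a b u y = - l\<^sup>2 * u y" and l: "l \<ge> 1"
    and L: "L \<ge> 0" "\<And>y. y \<in> cball z d \<Longrightarrow> (\<Sum>k\<in>UNIV. (partial_deriv k u y)\<^sup>2) \<le> L\<^sup>2"
    and m: "u z > 0"
  shows "l * u z \<le> (2 * d + 16 * real CARD('n) * N / d) * L"
proof -
  define W where "W = 4 * real CARD('n) * N"
  define r where "r = d / l"
  have W: "W > 0" using N(1) by (simp add: W_def)
  have r: "0 < r" "r \<le> d" "r * l = d" using d l by (auto simp: r_def divide_le_eq)
  have sub: "cball z r \<subseteq> cball z d" using r by (simp add: subset_cball)
  have zc: "z \<in> cball z d" using d by simp
  have osc: "\<bar>u y - u z\<bar> \<le> L * r" if "y \<in> cball z r" for y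
  proof -
    have "\<bar>u y - u z\<bar> \<le> L * norm (y - z)"
      by (rule gradient_bound_imp_lipschitz[OF convex_cball S(2) u L _ zc]) (use that sub in auto)
    also have "\<dots> \<le> L * r" using that L(1) by (intro mult_left_mono) (auto simp: dist_norm norm_minus_commute)
    finally show ?thesis .
  qed
  have split: "(2 * d + 16 * real CARD('n) * N / d) * L = 2 * d * L + 4 * W / d * L"
    by (simp add: W_def algebra_simps)
  show ?thesis
  proof (cases "u z / 2 \<le> L * r")
    case True
    then have "u z / 2 * l \<le> L * r * l" using l by (intro mult_right_mono) auto
    then have "l * u z \<le> 2 * (L * (r * l))" by (simp add: algebra_simps)
    then have "l * u z \<le> 2 * d * L" unfolding r(3) by (simp add: mult_ac)
    moreover have "4 * W / d * L \<ge> 0" using W d L by simp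
    ultimately show ?thesis unfolding split by linarith
  next
    case False
    have half: "u y > u z / 2" if "y \<in> cball z r" for y
      using osc[OF that] False by linarith
    \<comment> \<open>Half of the largest multiple for which the operator applied to the sum is seen to be negative.\<close>
    define \<kappa> where "\<kappa> = l\<^sup>2 * u z / (4 * W)"
    have \<kappa>: "\<kappa> > 0" using W m l by (simp add: \<kappa>_def)
    define q where "q y = (\<Sum>k\<in>UNIV. (y $ k - z $ k) * (y $ k - z $ k))" for y
    define \<phi> where "\<phi> y = u y + \<kappa> * q y" for y
    have sq: "smooth_on S q" unfolding q_def[abs_def] by (intro smooth_intros S)
    then have s\<phi>: "smooth_on S \<phi>" unfolding \<phi>_def[abs_def] by (intro smooth_intros S u)
    have q: "q y = (norm (y - z))\<^sup>2" for y
      unfolding q_def power2_norm_eq_inner by (simp add: inner_vec_def)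
    have "continuous_on (cball z r) \<phi>"
      using smooth_on_continuous[OF s\<phi>] S(2) sub by (blast intro: continuous_on_subset)
    then obtain y where y: "y \<in> cball z r" "\<And>x. x \<in> cball z r \<Longrightarrow> \<phi> y \<le> \<phi> x"
      using continuous_attains_inf[of "cball z r" \<phi>] r by auto
    have "y \<notin> ball z r"
    proof
      assume yb: "y \<in> ball z r"
      have yd: "y \<in> cball z d" using y(1) sub by blast
      then have yS: "y \<in> S" using S(2) by blast
      have bS: "ball z r \<subseteq> S" using S(2) sub by (meson ball_subset_cball order.trans)
      have "second_order_op a b (\<lambda>x. - 1 * \<phi> x) y \<le> 0"
        by (rule second_order_op_local_max[OF open_ball yb, where a = a, OF _ _ sym[OF yd] psd[OF yd]])
          (use y(2) ball_subset_cball[of z r] in \<open>auto intro!: smooth_on_subset[OF _ bS] smooth_on_mult[OF S(1) smooth_on_const s\<phi>, of "-1", simplified]\<close>)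
      then have "0 \<le> second_order_op a b \<phi> y"
        using second_order_op_cmult[OF S(1) yS s\<phi>, where a = a and b = b and c = "- 1"] by simp
      also have "\<dots> = - l\<^sup>2 * u y + \<kappa> * second_order_op a b q y"
        unfolding \<phi>_def[abs_def]
        using second_order_op_add[OF S(1) yS u smooth_on_mult[OF S(1) smooth_on_const sq], where a = a and b = b]
          second_order_op_cmult[OF S(1) yS sq, where a = a and b = b] eq[OF yS] by simp
      also have "second_order_op a b q y = (\<Sum>k\<in>UNIV. 2 * ((y $ k - z $ k) * b k y) + 2 * a k k y)"
        unfolding q_def[abs_def] by (rule second_order_op_square_dist[OF S(1) yS, where a = a, OF sym[OF yd]])
      also have "\<kappa> * \<dots> \<le> \<kappa> * W"
      proof (rule mult_left_mono)
        have "\<bar>y $ k - z $ k\<bar> \<le> 1" for k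
          using component_le_norm_cart[of "y - z" k] yd d by (simp add: dist_norm norm_minus_commute)
        then have "\<bar>2 * ((y $ k - z $ k) * b k y) + 2 * a k k y\<bar> \<le> 2 * (1 * N) + 2 * N" for k
          by (intro order.trans[OF abs_triangle_ineq] add_mono abs_mult_le N yd) simp_all
        then have "\<bar>\<Sum>k\<in>UNIV. 2 * ((y $ k - z $ k) * b k y) + 2 * a k k y\<bar> \<le> real CARD('n) * (2 * (1 * N) + 2 * N)"
          by (rule abs_sum_le_card)
        then show "(\<Sum>k\<in>UNIV. 2 * ((y $ k - z $ k) * b k y) + 2 * a k k y) \<le> W"
          by (simp add: W_def algebra_simps)
      qed (use \<kappa> in simp)
      also have "\<kappa> * W = l\<^sup>2 * u z / 4" using W by (simp add: \<kappa>_def)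
      finally have "l\<^sup>2 * u y \<le> l\<^sup>2 * (u z / 4)" by simp
      then have "u y \<le> u z / 4" using l by simp
      then show False using half[OF y(1)] m by linarith
    qed
    then have "norm (y - z) = r" using y(1) by (simp add: dist_norm norm_minus_commute)
    moreover have "\<phi> y \<le> \<phi> z" using y(2)[of z] r by simp
    ultimately have "\<kappa> * r\<^sup>2 \<le> u z - u y" by (simp add: \<phi>_def q)
    also have "\<dots> \<le> L * r" using osc[OF y(1)] by linarith
    finally have "\<kappa> * r \<le> L" using r(1) by (simp add: power2_eq_square)
    then have "l\<^sup>2 * u z * r \<le> 4 * W * L" using W by (simp add: \<kappa>_def field_simps)
    moreover have "l\<^sup>2 * u z * r = (l * u z) * d" unfolding r(3)[symmetric] by (simp add: power2_eq_square mult_ac)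
    ultimately have "(l * u z) * d \<le> 4 * W * L" by linarith
    then have "l * u z \<le> 4 * W * L / d" using d by (simp only: pos_le_divide_eq)
    then have "l * u z \<le> 4 * W / d * L" by simp
    moreover have "2 * d * L \<ge> 0" using d L by simp
    ultimately show ?thesis unfolding split by linarith
  qed
qed

text \<open>
  At a point where \<open>u\<close> is negative the estimate is applied to \<open>- u\<close>, which solves the same equation.
\<close>

lemma barrier_lower_bound_abs:
  fixes a :: "'n::finite \<Rightarrow> 'n \<Rightarrow> real ^ 'n \<Rightarrow> real"
  assumes S: "open S" "cball z d \<subseteq> S" and d: "0 < d" "d \<le> 1" and u: "smooth_on S u"
    and coeff: "\<And>i j y. y \<in> cball z d \<Longrightarrow> a i j y = a j i y"
      "\<And>v y. y \<in> cball z d \<Longrightarrow> (\<Sum>i\<in>UNIV. \<Sum>j\<in>UNIV. a i j y * v i * v j) \<ge> 0"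
    and N: "N > 0" "\<And>i j y. y \<in> cball z d \<Longrightarrow> \<bar>a i j y\<bar> \<le> N" "\<And>i y. y \<in> cball z d \<Longrightarrow> \<bar>b i y\<bar> \<le> N"
    and eq: "\<And>y. y \<in> S \<Longrightarrow> second_order_op a b u y = - l\<^sup>2 * u y" and l: "l \<ge> 1"
    and L: "L \<ge> 0" "\<And>y. y \<in> cball z d \<Longrightarrow> (\<Sum>k\<in>UNIV. (partial_deriv k u y)\<^sup>2) \<le> L\<^sup>2"
  shows "l * \<bar>u z\<bar> \<le> (2 * d + 16 * real CARD('n) * N / d) * L"
proof -
  consider "u z = 0" | "u z > 0" | "u z < 0" by linarith
  then show ?thesis
  proof cases
    case 1
    then show ?thesis using d N(1) L(1) by simp
  next
    case 2
    have "l * u z \<le> (2 * d + 16 * real CARD('n) * N / d) * L"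
      by (rule barrier_lower_bound[where a = a and b = b, OF S d u coeff N eq l L 2])
    then show ?thesis using 2 by simp
  next
    case 3
    have zS: "y \<in> S" if "y \<in> cball z d" for y using that S(2) by blast
    have "l * (- 1 * u z) \<le> (2 * d + 16 * real CARD('n) * N / d) * L"
    proof (rule barrier_lower_bound[where a = a and b = b, OF S d _ coeff N _ l L(1)])
      show "smooth_on S (\<lambda>y. - 1 * u y)" by (rule smooth_on_mult[OF S(1) smooth_on_const u])
      show "second_order_op a b (\<lambda>y. - 1 * u y) y = - l\<^sup>2 * (- 1 * u y)" if "y \<in> S" for y
        using second_order_op_cmult[OF S(1) that u, where a = a and b = b and c = "- 1"] eq[OF that] by simp
      show "(\<Sum>k\<in>UNIV. (partial_deriv k (\<lambda>y. - 1 * u y) y)\<^sup>2) \<le> L\<^sup>2" if "y \<in> cball z d" for y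
        using L(2)[OF that] unfolding partial_deriv_cmult[OF u zS[OF that]] by simp
      show "- 1 * u z > 0" using 3 by simp
    qed
    then show ?thesis using 3 by simp
  qed
qed

section \<open>Positive definite matrices depending smoothly on a parameter\<close>

lemma smooth_on_det:
  fixes A :: "real ^ 'n \<Rightarrow> real ^ 'k::finite ^ 'k"
  assumes S: "open S" and A: "\<And>i j. smooth_on S (\<lambda>x. A x $ i $ j)"
  shows "smooth_on S (\<lambda>x. det (A x))"
  unfolding det_def by (intro smooth_intros smooth_on_prod S A)

lemma matrix_inv_nth_cramer:
  fixes A :: "real ^ 'n::finite ^ 'n"
  assumes "invertible A"
  shows "matrix_inv A $ i $ j = det (\<chi> r s. if s = i then (if r = j then 1 else 0) else A $ r $ s) / det A"
proof -
  have "A *v (matrix_inv A *v axis j 1) = axis j 1"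
    using invertible_matrix_inv_right[OF assms] by (simp add: matrix_vector_mul_assoc)
  then have "(matrix_inv A *v axis j 1) $ i = det (\<chi> r s. if s = i then axis j 1 $ r else A $ r $ s) / det A"
    using cramer[of A "matrix_inv A *v axis j 1" "axis j 1"] assms by (simp add: invertible_det_nz)
  moreover have "(matrix_inv A *v axis j 1) $ i = matrix_inv A $ i $ j"
    by (simp add: matrix_vector_mult_basis column_def)
  moreover have "(\<chi> r s. if s = i then axis j 1 $ r else A $ r $ s) = (\<chi> r s. if s = i then (if r = j then 1 else 0) else A $ r $ s)"
    by (auto simp: axis_def vec_eq_iff)
  ultimately show ?thesis by simp
qed

text \<open>
  By Cramer's rule the entries of the inverse are quotients of polynomials in the entries.
\<close>

lemma smooth_on_matrix_inv:
  fixes A :: "real ^ 'n \<Rightarrow> real ^ 'k::finite ^ 'k"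
  assumes S: "open S" and A: "\<And>i j. smooth_on S (\<lambda>x. A x $ i $ j)"
    and inv: "\<And>x. x \<in> S \<Longrightarrow> invertible (A x)"
  shows "smooth_on S (\<lambda>x. matrix_inv (A x) $ i $ j)"
proof -
  have "smooth_on S (\<lambda>x. (\<chi> r s. if s = i then (if r = j then 1 else 0) else A x $ r $ s) $ r $ s)" for r s
    by (cases "s = i") (simp_all add: A smooth_on_const)
  then have "smooth_on S (\<lambda>x. det (\<chi> r s. if s = i then (if r = j then 1 else 0) else A x $ r $ s) / det (A x))"
    by (intro smooth_on_divide smooth_on_det S A) (use inv in \<open>auto simp: invertible_det_nz\<close>)
  then show ?thesis
    by (rule smooth_on_cong[OF S, rotated]) (simp add: matrix_inv_nth_cramer inv)
qed

text \<open>
  The segment from the identity to \<open>A\<close> consists of positive definite, hence invertible, matrices, so the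
  determinant cannot change sign along it. Positivity is what makes the square root in the Laplacian smooth.
\<close>

lemma det_pos_if_posdef:
  fixes A :: "real ^ 'n::finite ^ 'n"
  assumes pos: "\<And>v. v \<noteq> 0 \<Longrightarrow> v \<bullet> (A *v v) > 0"
  shows "det A > 0"
proof (rule ccontr)
  assume neg: "\<not> det A > 0"
  define B where "B t = (\<chi> i j. (1 - t) * (if i = j then 1 else 0) + t * A $ i $ j)" for t :: real
  have B: "B t *v v = (1 - t) *\<^sub>R v + t *\<^sub>R (A *v v)" for t v
  proof -
    have "(B t *v v) $ i = ((1 - t) *\<^sub>R v + t *\<^sub>R (A *v v)) $ i" for i
    proof -
      have "(B t *v v) $ i = (\<Sum>j\<in>UNIV. (if j = i then (1 - t) * v $ i else 0) + t * (A $ i $ j * v $ j))"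
        unfolding matrix_vector_mult_def B_def by (auto intro!: sum.cong simp: algebra_simps)
      then show ?thesis by (simp add: sum.distrib matrix_vector_mult_def sum_distrib_left)
    qed
    then show ?thesis by (simp add: vec_eq_iff)
  qed
  have nz: "det (B t) \<noteq> 0" if t: "0 \<le> t" "t \<le> 1" for t
  proof -
    have "v = 0" if "B t *v v = 0" for v
    proof (rule ccontr)
      assume v: "v \<noteq> 0"
      have "v \<bullet> (B t *v v) = (1 - t) * (v \<bullet> v) + t * (v \<bullet> (A *v v))" by (simp add: B inner_add_right)
      also have "\<dots> > 0"
        using t pos[OF v] v by (cases "t = 0") (auto intro!: add_nonneg_pos)
      finally show False using that by simp
    qed
    then show ?thesis
      using matrix_left_invertible_ker[of "B t"] invertible_left_inverse invertible_det_nz by blast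
  qed
  have "B 0 = mat 1" "B 1 = A" by (simp_all add: B_def vec_eq_iff mat_def)
  moreover have "continuous_on {0..1} (\<lambda>t. det (B t))"
    unfolding det_def B_def by (simp, intro continuous_intros)
  ultimately obtain t where "0 \<le> t" "t \<le> 1" "det (B t) = 0"
    using IVT2'[of "\<lambda>t. det (B t)" 1 0 0] neg by auto
  then show False using nz by blast
qed

lemma matrix_inv_symmetric_posdef:
  fixes A :: "real ^ 'n::finite ^ 'n"
  assumes sym: "transpose A = A" and pos: "\<And>v. v \<noteq> 0 \<Longrightarrow> v \<bullet> (A *v v) > 0" and inv: "invertible A"
  shows "matrix_inv A $ i $ j = matrix_inv A $ j $ i"
    and "v \<noteq> 0 \<Longrightarrow> v \<bullet> (matrix_inv A *v v) > 0"
proof -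
  let ?I = "matrix_inv A"
  have AI: "A *v (?I *v w) = w" for w
    using invertible_matrix_inv_right[OF inv] by (simp add: matrix_vector_mul_assoc)
  have adj: "(A *v x) \<bullet> y = x \<bullet> (A *v y)" for x y
    by (metis sym dot_lmul_matrix transpose_matrix_vector)
  have "x \<bullet> (?I *v y) = (?I *v x) \<bullet> y" for x y
    using adj[of "?I *v x" "?I *v y"] by (simp add: AI)
  from this[of "axis i 1" "axis j 1"] show "?I $ i $ j = ?I $ j $ i"
    by (simp add: matrix_vector_mult_basis column_def inner_axis inner_commute[of "axis i 1"])
  assume v: "v \<noteq> 0"
  then have "?I *v v \<noteq> 0" using AI[of v] by auto
  from pos[OF this] show "v \<bullet> (?I *v v) > 0" by (simp add: AI inner_commute)
qed

section \<open>The Laplacian in a chart\<close>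

definition inv_metric_coeff :: "('m, 'n::finite) riem_mfd \<Rightarrow> ('m, 'n) chart \<Rightarrow> 'n \<Rightarrow> 'n \<Rightarrow> real ^ 'n \<Rightarrow> real" where
  "inv_metric_coeff M c i j x = inv_metric M c (coord_inv c x) $ i $ j"

definition volume_density :: "('m, 'n::finite) riem_mfd \<Rightarrow> ('m, 'n) chart \<Rightarrow> real ^ 'n \<Rightarrow> real" where
  "volume_density M c x = sqrt (det (metric_tensor M c (coord_inv c x)))"

text \<open>
  The first-order coefficient that appears when the divergence form of the Laplacian is expanded.
\<close>

definition drift_coeff :: "('m, 'n::finite) riem_mfd \<Rightarrow> ('m, 'n) chart \<Rightarrow> 'n \<Rightarrow> real ^ 'n \<Rightarrow> real" where
  "drift_coeff M c j x =
     (\<Sum>i\<in>UNIV. partial_deriv i (\<lambda>y. inv_metric_coeff M c i j y * volume_density M c y) x) / volume_density M c x"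

lemma riemannian_manifold_chart:
  assumes "riemannian_manifold M" "c \<in> atlas M"
  shows "is_chart (mfd_top M) c" "open (chart_image c)"
  using assms unfolding riemannian_manifold_def smooth_atlas_def is_chart_def by blast+

lemma coord_inv_in_chart:
  assumes "x \<in> chart_image c"
  shows "coord_inv c x \<in> chart_dom c" "coord c (coord_inv c x) = x"
  using assms unfolding chart_image_def coord_inv_def by (auto intro: inv_into_into f_inv_into_f)

lemma chart_coefficients:
  assumes M: "riemannian_manifold M" "c \<in> atlas M"
  shows "smooth_on (chart_image c) (inv_metric_coeff M c i j)"
    and "smooth_on (chart_image c) (volume_density M c)"
    and "smooth_on (chart_image c) (drift_coeff M c j)"
    and "x \<in> chart_image c \<Longrightarrow> inv_metric_coeff M c i j x = inv_metric_coeff M c j i x"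
    and "x \<in> chart_image c \<Longrightarrow> volume_density M c x > 0"
    and "x \<in> chart_image c \<Longrightarrow> v \<noteq> 0 \<Longrightarrow>
      (\<Sum>i\<in>UNIV. \<Sum>j\<in>UNIV. inv_metric_coeff M c i j x * v $ i * v $ j) > 0"
proof -
  let ?G = "\<lambda>x. metric_tensor M c (coord_inv c x)"
  note S = riemannian_manifold_chart(2)[OF M]
  have G: "smooth_on (chart_image c) (\<lambda>x. ?G x $ i $ j)" for i j
    using M unfolding riemannian_manifold_def is_riemannian_metric_def by blast
  have pos: "w \<bullet> (?G x *v w) > 0" if "x \<in> chart_image c" "w \<noteq> 0" for x w
    using M coord_inv_in_chart(1)[OF that(1)] that(2)
    unfolding riemannian_manifold_def is_riemannian_metric_def by blast
  note sym = riemannian_metric_posdef(1)[OF M coord_inv_in_chart(1)]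
    and inv = riemannian_metric_posdef(2)[OF M coord_inv_in_chart(1)]
  show a: "smooth_on (chart_image c) (inv_metric_coeff M c i j)" for i j
    unfolding inv_metric_coeff_def[abs_def] inv_metric_def by (rule smooth_on_matrix_inv[OF S G inv])
  have det: "det (?G x) > 0" if "x \<in> chart_image c" for x
    by (rule det_pos_if_posdef) (rule pos[OF that])
  show s: "smooth_on (chart_image c) (volume_density M c)"
    unfolding volume_density_def[abs_def] by (intro smooth_on_sqrt smooth_on_det S G det)
  show spos: "volume_density M c x > 0" if "x \<in> chart_image c" for x
    using det[OF that] by (simp add: volume_density_def)
  have "smooth_on (chart_image c) (partial_deriv i (\<lambda>y. inv_metric_coeff M c i j y * volume_density M c y))" for i
    by (intro smooth_intros S a s)
  then show "smooth_on (chart_image c) (drift_coeff M c j)"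
    unfolding drift_coeff_def[abs_def]
    by (intro smooth_on_divide smooth_on_sum S s) (use spos in force)+
  show "inv_metric_coeff M c i j x = inv_metric_coeff M c j i x" if "x \<in> chart_image c" for x
    unfolding inv_metric_coeff_def inv_metric_def
    by (rule matrix_inv_symmetric_posdef(1)[OF sym[OF that] pos[OF that] inv[OF that]])
  show "(\<Sum>i\<in>UNIV. \<Sum>j\<in>UNIV. inv_metric_coeff M c i j x * v $ i * v $ j) > 0"
    if "x \<in> chart_image c" "v \<noteq> 0" for x
    using matrix_inv_symmetric_posdef(2)[OF sym[OF that(1)] pos[OF that(1)] inv[OF that(1)] that(2)]
    by (simp add: inv_metric_coeff_def inv_metric_def inner_vec_def matrix_vector_mult_def sum_distrib_left mult_ac)
qed

lemma laplacian_in_eq_second_order_op: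
  assumes M: "riemannian_manifold M" "c \<in> atlas M" and f: "smooth_fun M f" and p: "p \<in> chart_dom c"
  shows "laplacian_in M f c p =
    - second_order_op (inv_metric_coeff M c) (drift_coeff M c) (local_rep f c) (coord c p)"
proof -
  let ?S = "chart_image c" and ?a = "inv_metric_coeff M c" and ?s = "volume_density M c"
    and ?u = "local_rep f c" and ?x = "coord c p"
  note coeff = chart_coefficients[OF M]
  have S: "open ?S" by (rule riemannian_manifold_chart(2)[OF M])
  have x: "?x \<in> ?S" using p by (simp add: chart_image_def)
  have u: "smooth_on ?S ?u" using f M unfolding smooth_fun_def by blast
  have s: "?s ?x > 0" by (rule coeff(5)[OF x])
  let ?d = "\<lambda>i j. partial_deriv i (\<lambda>y. ?a i j y * ?s y) ?x"
  have prod: "partial_deriv i (\<lambda>y. ?a i j y * ?s y * partial_deriv j ?u y) ?x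
     = ?s ?x * (?a i j ?x * partial_deriv i (partial_deriv j ?u) ?x) + ?d i j * partial_deriv j ?u ?x" for i j
    using partial_deriv_mult[OF smooth_on_mult[OF S coeff(1) coeff(2)] smooth_on_partial_deriv[OF u] x]
    by (simp add: mult_ac)
  have "(\<Sum>i\<in>UNIV. \<Sum>j\<in>UNIV. ?d i j * partial_deriv j ?u ?x) = ?s ?x * (\<Sum>j\<in>UNIV. drift_coeff M c j ?x * partial_deriv j ?u ?x)"
    using s by (subst sum.swap) (simp add: drift_coeff_def sum_distrib_right[symmetric] sum_distrib_left)
  then have "(\<Sum>i\<in>UNIV. \<Sum>j\<in>UNIV. partial_deriv i (\<lambda>y. ?a i j y * ?s y * partial_deriv j ?u y) ?x)
     = ?s ?x * second_order_op ?a (drift_coeff M c) ?u ?x"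
    by (simp add: prod sum.distrib second_order_op_def distrib_left sum_distrib_left)
  moreover have "laplacian_in M f c p = - (1 / ?s ?x) *
      (\<Sum>i\<in>UNIV. \<Sum>j\<in>UNIV. partial_deriv i (\<lambda>y. ?a i j y * ?s y * partial_deriv j ?u y) ?x)"
    unfolding laplacian_in_def Let_def inv_metric_coeff_def volume_density_def ..
  ultimately show ?thesis using s by simp
qed

lemma eigenfunction_local_equation:
  assumes M: "riemannian_manifold M" "c \<in> atlas M" and f: "eigenfunction M \<mu> f" and x: "x \<in> chart_image c"
  shows "second_order_op (inv_metric_coeff M c) (drift_coeff M c) (local_rep f c) x = - \<mu> * local_rep f c x"
proof -
  have "laplacian_in M f c (coord_inv c x) = \<mu> * f (coord_inv c x)"
    using f M coord_inv_in_chart(1)[OF x] unfolding eigenfunction_def has_laplacian_def by blast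
  moreover have "smooth_fun M f" using f by (simp add: eigenfunction_def)
  ultimately show ?thesis
    using laplacian_in_eq_second_order_op[OF M _ coord_inv_in_chart(1)[OF x], of f] coord_inv_in_chart(2)[OF x]
    by (simp add: local_rep_def)
qed

lemma gradient_length_square_carre_du_champ:
  assumes M: "riemannian_manifold M" "c \<in> atlas M" and f: "smooth_fun M f" and x: "x \<in> chart_image c"
  shows "(gradient_length M f (coord_inv c x))\<^sup>2 =
    carre_du_champ (inv_metric_coeff M c) (local_rep f c) (local_rep f c) x"
  using gradient_length_eq[OF M(1) f M(2)] gradient_length_in_square[OF M] coord_inv_in_chart[OF x]
  by (simp add: carre_du_champ_def inv_metric_coeff_def mult.assoc)

section \<open>Compactness\<close>

lemma continuous_family_bounded:
  fixes f :: "'i \<Rightarrow> 'a::topological_space \<Rightarrow> real"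
  assumes K: "compact K" and "finite I" "\<And>i. i \<in> I \<Longrightarrow> continuous_on K (f i)"
  shows "\<exists>N>0. \<forall>i\<in>I. \<forall>x\<in>K. \<bar>f i x\<bar> \<le> N"
  using assms(2,3)
proof (induction I rule: finite_induct)
  case empty
  then show ?case by (auto intro: exI[of _ 1])
next
  case (insert i I)
  then obtain N where N: "N > 0" "\<forall>i\<in>I. \<forall>x\<in>K. \<bar>f i x\<bar> \<le> N" by auto
  have "bounded (f i ` K)"
    using insert.prems by (intro compact_imp_bounded compact_continuous_image K) auto
  then obtain B where "\<forall>x\<in>K. \<bar>f i x\<bar> \<le> B" by (auto simp: bounded_real)
  then show ?case using N by (intro exI[of _ "max N B"]) (auto simp: le_max_iff_disj)
qed

text \<open>
  The quadratic form has a positive minimum on the product of \<open>K\<close> with the unit sphere, and it is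
  homogeneous of degree two.
\<close>

lemma uniform_ellipticity:
  fixes a :: "'n::finite \<Rightarrow> 'n \<Rightarrow> real ^ 'n \<Rightarrow> real"
  assumes K: "compact K" "K \<noteq> {}" and a: "\<And>i j. continuous_on K (a i j)"
    and pos: "\<And>x v. x \<in> K \<Longrightarrow> v \<noteq> 0 \<Longrightarrow> (\<Sum>i\<in>UNIV. \<Sum>j\<in>UNIV. a i j x * v $ i * v $ j) > 0"
  shows "\<exists>c>0. \<forall>x\<in>K. \<forall>v. c * (\<Sum>i\<in>UNIV. (v i)\<^sup>2) \<le> (\<Sum>i\<in>UNIV. \<Sum>j\<in>UNIV. a i j x * v i * v j)"
proof -
  define \<phi> where "\<phi> z = (\<Sum>i\<in>UNIV. \<Sum>j\<in>UNIV. a i j (fst z) * snd z $ i * snd z $ j)" for z :: "(real ^ 'n) \<times> (real ^ 'n)"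
  let ?T = "K \<times> sphere (0 :: real ^ 'n) 1"
  have "continuous_on ?T (\<lambda>z. a i j (fst z))" for i j
    by (rule continuous_on_compose2[OF a continuous_on_fst]) (auto intro: continuous_intros)
  then have cont: "continuous_on ?T \<phi>"
    unfolding \<phi>_def[abs_def] by (intro continuous_intros)
  have "axis undefined 1 \<in> sphere (0 :: real ^ 'n) 1" by simp
  then have "?T \<noteq> {}" using K(2) by blast
  then obtain z where z: "z \<in> ?T" "\<And>z'. z' \<in> ?T \<Longrightarrow> \<phi> z \<le> \<phi> z'"
    using continuous_attains_inf[OF compact_Times[OF K(1) compact_sphere] _ cont] by blast
  have "\<phi> z > 0" unfolding \<phi>_def using z(1) by (intro pos) auto
  moreover have "\<phi> z * (\<Sum>i\<in>UNIV. (v i)\<^sup>2) \<le> (\<Sum>i\<in>UNIV. \<Sum>j\<in>UNIV. a i j x * v i * v j)"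
    if x: "x \<in> K" for x and v :: "'n \<Rightarrow> real"
  proof -
    define w where "w = (\<chi> i. v i)"
    have w: "(norm w)\<^sup>2 = (\<Sum>i\<in>UNIV. (v i)\<^sup>2)"
      unfolding w_def power2_norm_eq_inner by (simp add: inner_vec_def power2_eq_square)
    show ?thesis
    proof (cases "w = 0")
      case True
      then have "v i = 0" for i by (simp add: w_def vec_eq_iff)
      then show ?thesis by simp
    next
      case False
      let ?e = "(1 / norm w) *\<^sub>R w"
      have le: "\<phi> z \<le> \<phi> (x, ?e)" using False x by (intro z(2)) simp
      moreover have "\<phi> (x, ?e) * (norm w)\<^sup>2 = (\<Sum>i\<in>UNIV. \<Sum>j\<in>UNIV. a i j x * v i * v j)"
      proof -
        have "a i j x * ?e $ i * ?e $ j * (norm w)\<^sup>2 = a i j x * v i * v j" for i j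
          using False by (simp add: w_def[THEN arg_cong[where f = "\<lambda>w. w $ _"]] power2_eq_square)
        then show ?thesis by (simp only: \<phi>_def sum_distrib_right fst_conv snd_conv)
      qed
      ultimately show ?thesis
        unfolding w[symmetric] using mult_right_mono[OF le zero_le_power2[of "norm w"]] by simp
    qed
  qed
  ultimately show ?thesis by blast
qed

lemma compact_space_uniform_const:
  fixes P :: "real \<Rightarrow> 'a \<Rightarrow> bool"
  assumes X: "compact_space X"
    and loc: "\<And>p. p \<in> topspace X \<Longrightarrow> \<exists>V C. openin X V \<and> p \<in> V \<and> (\<forall>q\<in>V. P C q)"
    and mono: "\<And>C C' q. P C q \<Longrightarrow> C \<le> C' \<Longrightarrow> P C' q"
  shows "\<exists>C. \<forall>q\<in>topspace X. P C q"
proof -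
  let ?\<U> = "{V. openin X V \<and> (\<exists>C. \<forall>q\<in>V. P C q)}"
  have "topspace X \<subseteq> \<Union>?\<U>" using loc by blast
  then obtain F where F: "finite F" "F \<subseteq> ?\<U>" "topspace X \<subseteq> \<Union>F"
    using X unfolding compact_space_alt by (metis (no_types, lifting) mem_Collect_eq)
  have "\<forall>V\<in>F. \<exists>C. \<forall>q\<in>V. P C q" using F(2) by blast
  then obtain C where C: "\<forall>V\<in>F. \<forall>q\<in>V. P (C V) q" by (rule bchoice[THEN exE])
  have "P (Max (C ` F)) q" if "q \<in> topspace X" for q
  proof -
    obtain V where "V \<in> F" "q \<in> V" using F(3) \<open>q \<in> topspace X\<close> by blast
    then show ?thesis using C F(1) mono[of "C V" q] by simp
  qed
  then show ?thesis by blast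
qed

lemma compact_space_attains_sup:
  assumes X: "compact_space X" "topspace X \<noteq> {}" and f: "continuous_map X euclideanreal f"
  shows "\<exists>p\<in>topspace X. \<forall>q\<in>topspace X. f q \<le> f p"
proof -
  have "compact (f ` topspace X)"
    using image_compactin[OF _ f] X(1) by (auto simp: compact_space_def)
  then show ?thesis using compact_attains_sup[of "f ` topspace X"] X(2) by auto
qed

lemma continuous_map_from_charts:
  assumes M: "riemannian_manifold M"
    and f: "\<And>c. c \<in> atlas M \<Longrightarrow> continuous_on (chart_image c) (\<lambda>x. f (coord_inv c x))"
  shows "continuous_map (mfd_top M) euclideanreal f"
proof (rule pasting_lemma)
  fix c assume c: "c \<in> atlas M"
  note ch = riemannian_manifold_chart(1)[OF M c]
  then show op: "openin (mfd_top M) (chart_dom c)" by (simp add: is_chart_def)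
  have "continuous_map (subtopology (mfd_top M) (chart_dom c)) (top_of_set (chart_image c)) (coord c)"
    using ch homeomorphic_imp_continuous_map by (auto simp: is_chart_def)
  moreover have "continuous_map (top_of_set (chart_image c)) euclideanreal (\<lambda>x. f (coord_inv c x))"
    using f[OF c] by simp
  ultimately have "continuous_map (subtopology (mfd_top M) (chart_dom c)) euclideanreal ((\<lambda>x. f (coord_inv c x)) \<circ> coord c)"
    by (rule continuous_map_compose)
  then show "continuous_map (subtopology (mfd_top M) (chart_dom c)) euclideanreal f"
    by (rule continuous_map_eq) (auto simp: chart_coord_inv(1)[OF ch])
next
  fix p assume "p \<in> points M"
  then show "\<exists>c. c \<in> atlas M \<and> p \<in> chart_dom c \<and> f p = f p"
    using M unfolding riemannian_manifold_def smooth_atlas_def by blast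
qed simp

section \<open>The two-sided gradient estimate\<close>

text \<open>
  The two estimates at a single point \<open>q\<close>, collected so that one constant can be made uniform by compactness.
  The first one is quantified over all \<open>A\<close> above \<open>C\<close> for two reasons: it makes the predicate monotone
  in \<open>C\<close>, and it permits \<open>A\<close> to be fixed after the uniform constant is known but before the maximum point is.
\<close>

definition gradient_estimates_at :: "('m, 'n::finite) riem_mfd \<Rightarrow> real \<Rightarrow> 'm \<Rightarrow> bool" where
  "gradient_estimates_at M C q \<longleftrightarrow> (\<forall>l e. l \<ge> 1 \<longrightarrow> eigenfunction M (l\<^sup>2) e \<longrightarrow>
     (\<forall>A\<ge>C. (\<forall>p\<in>points M. (gradient_length M e p)\<^sup>2 + A * l\<^sup>2 * (e p)\<^sup>2 \<le> (gradient_length M e q)\<^sup>2 + A * l\<^sup>2 * (e q)\<^sup>2)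
        \<longrightarrow> (gradient_length M e q)\<^sup>2 \<le> A * l\<^sup>2 * (e q)\<^sup>2) \<and>
     (\<forall>L\<ge>0. (\<forall>p\<in>points M. (gradient_length M e p)\<^sup>2 \<le> L\<^sup>2) \<longrightarrow> l * \<bar>e q\<bar> \<le> C * L))"

lemma gradient_estimates_at_mono:
  assumes "gradient_estimates_at M C q" "C \<le> C'"
  shows "gradient_estimates_at M C' q"
  unfolding gradient_estimates_at_def
proof (intro allI impI conjI)
  fix l e A assume "l \<ge> 1" "eigenfunction M (l\<^sup>2) e" "A \<ge> C'"
    "\<forall>p\<in>points M. (gradient_length M e p)\<^sup>2 + A * l\<^sup>2 * (e p)\<^sup>2 \<le> (gradient_length M e q)\<^sup>2 + A * l\<^sup>2 * (e q)\<^sup>2"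
  moreover from this have "A \<ge> C" using assms(2) by linarith
  ultimately show "(gradient_length M e q)\<^sup>2 \<le> A * l\<^sup>2 * (e q)\<^sup>2"
    using assms(1) unfolding gradient_estimates_at_def by blast
next
  fix l e and L :: real assume "l \<ge> 1" "eigenfunction M (l\<^sup>2) e" "L \<ge> 0" "\<forall>p\<in>points M. (gradient_length M e p)\<^sup>2 \<le> L\<^sup>2"
  then have "l * \<bar>e q\<bar> \<le> C * L" using assms(1) unfolding gradient_estimates_at_def by blast
  also have "\<dots> \<le> C' * L" using assms(2) \<open>L \<ge> 0\<close> by (rule mult_right_mono)
  finally show "l * \<bar>e q\<bar> \<le> C' * L" .
qed

text \<open>
  Near \<open>p\<close> the coefficients of the Laplacian in a chart satisfy uniform bounds on a compact coordinate
  ball \<open>K\<close>. Both estimates depend on the metric only through these bounds, so that one constant serves all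
  nearby points, eigenvalues and eigenfunctions.
\<close>

lemma local_gradient_estimates:
  fixes M :: "('m, 'n::finite) riem_mfd"
  assumes M: "riemannian_manifold M" and p: "p \<in> points M"
  shows "\<exists>V C. openin (mfd_top M) V \<and> p \<in> V \<and> (\<forall>q\<in>V. gradient_estimates_at M C q)"
proof -
  obtain c where c: "c \<in> atlas M" "p \<in> chart_dom c"
    using M p unfolding riemannian_manifold_def smooth_atlas_def by blast
  let ?S = "chart_image c" and ?a = "inv_metric_coeff M c" and ?b = "drift_coeff M c" and ?n = "real CARD('n)"
  note ch = riemannian_manifold_chart[OF M c(1)] and coeff = chart_coefficients[OF M c(1)]
  have dom_sub: "chart_dom c \<subseteq> points M" using ch(1) openin_subset unfolding is_chart_def by blast
  have "coord c p \<in> ?S" using c(2) by (simp add: chart_image_def)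
  then obtain e where e: "e > 0" "cball (coord c p) e \<subseteq> ?S" using ch(2) open_contains_cball by blast
  \<comment> \<open>Balls of radius d about points at distance less than d from the centre remain in K.\<close>
  define d where "d = min 1 (e / 2)"
  define K where "K = cball (coord c p) e"
  have d: "0 < d" "d \<le> 1" "2 * d \<le> e" using e by (auto simp: d_def)
  have K: "compact K" "K \<noteq> {}" "K \<subseteq> ?S" using e by (auto simp: K_def)
  have cont: "continuous_on K f" if "smooth_on ?S f" for f :: "real ^ 'n \<Rightarrow> real"
    using smooth_on_continuous[OF that] K(3) by (rule continuous_on_subset)

  obtain N1 where N1: "N1 > 0" "\<And>i j x. x \<in> K \<Longrightarrow> \<bar>?a i j x\<bar> \<le> N1"
    using continuous_family_bounded[OF K(1) finite, of UNIV "\<lambda>(i, j). ?a i j"] cont[OF coeff(1)] by (auto 5 0)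
  obtain N2 where N2: "N2 > 0" "\<And>i j k x. x \<in> K \<Longrightarrow> \<bar>partial_deriv k (?a i j) x\<bar> \<le> N2"
    using continuous_family_bounded[OF K(1) finite, of UNIV "\<lambda>(i, j, k). partial_deriv k (?a i j)"]
      cont[OF smooth_on_partial_deriv[OF coeff(1)]] by (auto 5 0)
  obtain N3 where N3: "N3 > 0" "\<And>i j k l x. x \<in> K \<Longrightarrow> \<bar>partial_deriv k (partial_deriv l (?a i j)) x\<bar> \<le> N3"
    using continuous_family_bounded[OF K(1) finite, of UNIV "\<lambda>(i, j, k, l). partial_deriv k (partial_deriv l (?a i j))"]
      cont[OF smooth_on_partial_deriv[OF smooth_on_partial_deriv[OF coeff(1)]]] by (auto 5 0)
  obtain N4 where N4: "N4 > 0" "\<And>i x. x \<in> K \<Longrightarrow> \<bar>?b i x\<bar> \<le> N4"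
    using continuous_family_bounded[OF K(1) finite, of UNIV ?b] cont[OF coeff(3)] by (auto 5 0)
  obtain N5 where N5: "N5 > 0" "\<And>i k x. x \<in> K \<Longrightarrow> \<bar>partial_deriv k (?b i) x\<bar> \<le> N5"
    using continuous_family_bounded[OF K(1) finite, of UNIV "\<lambda>(i, k). partial_deriv k (?b i)"]
      cont[OF smooth_on_partial_deriv[OF coeff(3)]] by (auto 5 0)
  define N where "N = N1 + N2 + N3 + N4 + N5"
  have N: "N1 \<le> N" "N2 \<le> N" "N3 \<le> N" "N4 \<le> N" "N5 \<le> N" "N > 0"
    using N1(1) N2(1) N3(1) N4(1) N5(1) by (simp_all add: N_def)
  have "\<exists>c>0. \<forall>x\<in>K. \<forall>v. c * (\<Sum>i\<in>UNIV. (v i)\<^sup>2) \<le> (\<Sum>i\<in>UNIV. \<Sum>j\<in>UNIV. ?a i j x * v i * v j)"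
    by (rule uniform_ellipticity[OF K(1,2) cont[OF coeff(1)]], rule coeff(6)) (use K(3) in auto)
  then obtain \<epsilon> where \<epsilon>: "\<epsilon> > 0"
    "\<And>x v. x \<in> K \<Longrightarrow> \<epsilon> * (\<Sum>i\<in>UNIV. (v i)\<^sup>2) \<le> (\<Sum>i\<in>UNIV. \<Sum>j\<in>UNIV. ?a i j x * v i * v j)"
    by blast
  define C1 where "C1 = bernstein_const ?n \<epsilon> N"
  define C2 where "C2 = (2 * d + 16 * ?n * N / d) / sqrt \<epsilon>"
  define V where "V = {q \<in> chart_dom c. coord c q \<in> ball (coord c p) d}"

  have "openin (mfd_top M) V"
  proof -
    have "continuous_map (subtopology (mfd_top M) (chart_dom c)) (top_of_set ?S) (coord c)"
      using ch(1) homeomorphic_imp_continuous_map by (auto simp: is_chart_def)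
    then have "continuous_map (subtopology (mfd_top M) (chart_dom c)) euclidean (coord c)"
      by (simp add: continuous_map_in_subtopology)
    then have "openin (subtopology (mfd_top M) (chart_dom c))
        {q \<in> topspace (subtopology (mfd_top M) (chart_dom c)). coord c q \<in> ball (coord c p) d}"
      by (rule openin_continuous_map_preimage) simp
    also have "{q \<in> topspace (subtopology (mfd_top M) (chart_dom c)). coord c q \<in> ball (coord c p) d} = V"
      using dom_sub by (auto simp: V_def)
    finally show ?thesis
      using ch(1) openin_open_subtopology unfolding is_chart_def by blast
  qed
  moreover have "p \<in> V" using c(2) d(1) by (simp add: V_def)
  moreover have "gradient_estimates_at M (max C1 C2) q" if q: "q \<in> V" for q
    unfolding gradient_estimates_at_def
  proof (intro allI impI conjI)
    fix l :: real and f :: "'m \<Rightarrow> real"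
    assume l: "l \<ge> 1" and f: "eigenfunction M (l\<^sup>2) f"
    let ?u = "local_rep f c" and ?z = "coord c q"
    have sf: "smooth_fun M f" using f by (simp add: eigenfunction_def)
    have u: "smooth_on ?S ?u" using sf c(1) unfolding smooth_fun_def by blast
    have eq: "second_order_op ?a ?b ?u y = - l\<^sup>2 * ?u y" if "y \<in> ?S" for y
      by (rule eigenfunction_local_equation[OF M c(1) f that])
    have grad: "(gradient_length M f (coord_inv c y))\<^sup>2 = carre_du_champ ?a ?u ?u y" if "y \<in> ?S" for y
      by (rule gradient_length_square_carre_du_champ[OF M c(1) sf that])
    have mem: "coord_inv c y \<in> points M" if "y \<in> ?S" for y
      using coord_inv_in_chart(1)[OF that] dom_sub by blast
    have qd: "q \<in> chart_dom c" "dist (coord c p) ?z < d" using q by (auto simp: V_def)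
    have qz: "coord_inv c ?z = q" by (rule chart_coord_inv(1)[OF ch(1) qd(1)])
    have zS: "?z \<in> ?S" using qd(1) by (simp add: chart_image_def)
    have zK: "cball ?z d \<subseteq> K"
    proof
      fix y assume "y \<in> cball ?z d"
      then have "dist (coord c p) y \<le> 2 * d"
        using dist_triangle[of "coord c p" y ?z] qd(2) by simp
      then show "y \<in> K" using d(3) by (simp add: K_def)
    qed
    have fz: "?u ?z = f q" by (simp add: local_rep_def qz)
    show "(gradient_length M f q)\<^sup>2 \<le> A * l\<^sup>2 * (f q)\<^sup>2"
      if A: "A \<ge> max C1 C2" and max: "\<forall>p\<in>points M. (gradient_length M f p)\<^sup>2 + A * l\<^sup>2 * (f p)\<^sup>2
          \<le> (gradient_length M f q)\<^sup>2 + A * l\<^sup>2 * (f q)\<^sup>2" for A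
    proof -
      have zin: "?z \<in> K" using zK d(1) by auto
      have "carre_du_champ ?a ?u ?u ?z \<le> A * l\<^sup>2 * (?u ?z)\<^sup>2"
      proof (rule bernstein_gradient_bound_at_max[where b = ?b and c = \<epsilon> and N = N, OF ch(2) zS u coeff(1) coeff(3) coeff(4)[OF zS] \<epsilon>(1) \<epsilon>(2)[OF zin] _ _ _ _ _ eq])
        show "1 \<le> l\<^sup>2" using l by simp
        show "bernstein_const ?n \<epsilon> N \<le> A" using A by (simp add: C1_def)
        show "carre_du_champ ?a ?u ?u y + A * l\<^sup>2 * (?u y)\<^sup>2 \<le> carre_du_champ ?a ?u ?u ?z + A * l\<^sup>2 * (?u ?z)\<^sup>2"
          if "y \<in> ?S" for y
          using bspec[OF max mem[OF that]] grad[OF that] grad[OF zS] by (simp add: local_rep_def qz)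
      qed (use N N1(2)[OF zin] N2(2)[OF zin] N3(2)[OF zin] N4(2)[OF zin] N5(2)[OF zin] in \<open>blast intro: order.trans\<close>)+
      then show ?thesis using grad[OF zS] by (simp add: fz qz)
    qed
    show "l * \<bar>f q\<bar> \<le> max C1 C2 * L"
      if L: "L \<ge> 0" and gL: "\<forall>p\<in>points M. (gradient_length M f p)\<^sup>2 \<le> L\<^sup>2" for L
    proof -
      have "l * \<bar>?u ?z\<bar> \<le> (2 * d + 16 * ?n * N / d) * (L / sqrt \<epsilon>)"
      proof (rule barrier_lower_bound_abs[where a = ?a and b = ?b, OF ch(2) _ d(1,2) u _ _ N(6) _ _ eq l])
        show "cball ?z d \<subseteq> ?S" using zK K(3) by blast
        show "L / sqrt \<epsilon> \<ge> 0" using L \<epsilon>(1) by simp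
        fix y assume "y \<in> cball ?z d"
        then have y: "y \<in> K" "y \<in> ?S" using zK K(3) by auto
        show "?a i j y = ?a j i y" for i j by (rule coeff(4)[OF y(2)])
        show "(\<Sum>i\<in>UNIV. \<Sum>j\<in>UNIV. ?a i j y * v i * v j) \<ge> 0" for v
          by (rule order.trans[OF _ \<epsilon>(2)[OF y(1)]]) (use \<epsilon>(1) in \<open>simp add: sum_nonneg\<close>)
        show "\<bar>?a i j y\<bar> \<le> N" for i j using N1(2)[OF y(1)] N(1) by (rule order.trans)
        show "\<bar>?b i y\<bar> \<le> N" for i using N4(2)[OF y(1)] N(4) by (rule order.trans)
        have "\<epsilon> * (\<Sum>k\<in>UNIV. (partial_deriv k ?u y)\<^sup>2) \<le> carre_du_champ ?a ?u ?u y"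
          using \<epsilon>(2)[OF y(1), of "\<lambda>k. partial_deriv k ?u y"] by (simp add: carre_du_champ_def mult.assoc)
        also have "\<dots> \<le> L\<^sup>2" using bspec[OF gL mem[OF y(2)]] grad[OF y(2)] by simp
        finally show "(\<Sum>k\<in>UNIV. (partial_deriv k ?u y)\<^sup>2) \<le> (L / sqrt \<epsilon>)\<^sup>2"
          using \<epsilon>(1) by (simp add: power_divide field_simps)
      qed
      also have "\<dots> = C2 * L" by (simp add: C2_def)
      also have "\<dots> \<le> max C1 C2 * L" using L by (intro mult_right_mono) auto
      finally show ?thesis by (simp add: fz)
    qed
  qed
  ultimately show ?thesis by blast
qed

theorem mainTheorem1:
  fixes M :: "('m, 'n::finite) riem_mfd"
  assumes "compact_riemannian_manifold M"
  shows "\<exists>C::real. C > 0 \<and>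
    (\<forall>(l::real) (e :: 'm \<Rightarrow> real). l \<ge> 1 \<longrightarrow> eigenfunction M (l\<^sup>2) e \<longrightarrow>
       l * sup_norm M e / C \<le> sup_norm M (gradient_length M e) \<and>
       sup_norm M (gradient_length M e) \<le> C * l * sup_norm M e)"
proof -
  have M: "riemannian_manifold M" and X: "compact_space (mfd_top M)"
    using assms unfolding compact_riemannian_manifold_def by auto
  have "\<exists>C. \<forall>q\<in>points M. gradient_estimates_at M C q"
    by (rule compact_space_uniform_const[OF X]) (fact local_gradient_estimates[OF M], fact gradient_estimates_at_mono)
  then obtain C0 where C0: "\<forall>q\<in>points M. gradient_estimates_at M C0 q" ..
  define A where "A = max C0 1"
  define C where "C = max (sqrt (2 * A)) C0"
  have A: "A \<ge> C0" "A \<ge> 1" by (simp_all add: A_def)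
  have C: "C \<ge> sqrt (2 * A)" "C \<ge> C0" "C > 0" using A by (auto simp: C_def less_max_iff_disj)
  have "l * sup_norm M e / C \<le> sup_norm M (gradient_length M e) \<and>
      sup_norm M (gradient_length M e) \<le> C * l * sup_norm M e"
    if l: "l \<ge> 1" and e: "eigenfunction M (l\<^sup>2) e" for l and e :: "'m \<Rightarrow> real"
  proof -
    let ?g = "gradient_length M e"
    have se: "smooth_fun M e" and ne: "points M \<noteq> {}" using e by (auto simp: eigenfunction_def)
    have u: "smooth_on (chart_image c) (local_rep e c)" if "c \<in> atlas M" for c
      using se that by (simp add: smooth_fun_def)
    have "continuous_map (mfd_top M) euclideanreal (\<lambda>p. \<bar>e p\<bar>)"
    proof (rule continuous_map_from_charts[OF M])
      fix c assume "c \<in> atlas M"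
      from smooth_on_continuous[OF u[OF this]]
      show "continuous_on (chart_image c) (\<lambda>x. \<bar>e (coord_inv c x)\<bar>)"
        by (intro continuous_intros) (simp add: local_rep_def o_def)
    qed
    from compact_space_attains_sup[OF X ne this]
    obtain p0 where p0: "p0 \<in> points M" "\<And>q. q \<in> points M \<Longrightarrow> \<bar>e q\<bar> \<le> \<bar>e p0\<bar>" by blast
    have norm_e: "sup_norm M e = \<bar>e p0\<bar>"
      unfolding sup_norm_def using p0 by (intro cSup_eq_maximum) auto
    have "continuous_map (mfd_top M) euclideanreal (\<lambda>p. (?g p)\<^sup>2 + A * l\<^sup>2 * (e p)\<^sup>2)"
    proof (rule continuous_map_from_charts[OF M])
      fix c assume c: "c \<in> atlas M"
      note S = riemannian_manifold_chart(2)[OF M c]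
      have rep: "local_rep e c x = e (coord_inv c x)" for x by (simp add: local_rep_def)
      have "smooth_on (chart_image c) (\<lambda>x. carre_du_champ (inv_metric_coeff M c) (local_rep e c) (local_rep e c) x
          + A * l\<^sup>2 * (local_rep e c x * local_rep e c x))"
        unfolding carre_du_champ_def by (intro smooth_intros S chart_coefficients(1)[OF M c] u c)
      then show "continuous_on (chart_image c) (\<lambda>x. (?g (coord_inv c x))\<^sup>2 + A * l\<^sup>2 * (e (coord_inv c x))\<^sup>2)"
        by (rule smooth_on_continuous[THEN continuous_on_eq])
          (simp add: gradient_length_square_carre_du_champ[OF M c se] rep power2_eq_square[of "e _"])
    qed
    from compact_space_attains_sup[OF X ne this]
    obtain q where q: "q \<in> points M"
      "\<forall>p\<in>points M. (?g p)\<^sup>2 + A * l\<^sup>2 * (e p)\<^sup>2 \<le> (?g q)\<^sup>2 + A * l\<^sup>2 * (e q)\<^sup>2" by blast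
    have gq: "(?g q)\<^sup>2 \<le> A * l\<^sup>2 * (e q)\<^sup>2"
      by (rule C0[rule_format, OF q(1), unfolded gradient_estimates_at_def, rule_format, OF l e,
            THEN conjunct1, rule_format, OF A(1)]) (rule bspec[OF q(2)])
    \<comment> \<open>Compare the auxiliary function at p with its maximum, and bound the maximum by the pointwise estimate at q.\<close>
    have upper: "\<bar>?g p\<bar> \<le> C * l * \<bar>e p0\<bar>" if "p \<in> points M" for p
    proof -
      have "(?g p)\<^sup>2 \<le> (?g p)\<^sup>2 + A * l\<^sup>2 * (e p)\<^sup>2" using A by simp
      also have "\<dots> \<le> 2 * A * l\<^sup>2 * (e q)\<^sup>2" using bspec[OF q(2) that] gq by simp
      also have "\<dots> \<le> 2 * A * l\<^sup>2 * \<bar>e p0\<bar>\<^sup>2"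
        using p0(2)[OF q(1)] A by (intro mult_left_mono) (auto simp: abs_le_square_iff)
      also have "\<dots> = (sqrt (2 * A) * l * \<bar>e p0\<bar>)\<^sup>2" using A by (simp add: power_mult_distrib)
      finally have "\<bar>?g p\<bar> \<le> \<bar>sqrt (2 * A) * l * \<bar>e p0\<bar>\<bar>" by (simp only: abs_le_square_iff)
      also have "\<dots> = sqrt (2 * A) * l * \<bar>e p0\<bar>" using A l by (simp add: abs_mult)
      also have "\<dots> \<le> C * l * \<bar>e p0\<bar>" using C l by (intro mult_right_mono) auto
      finally show ?thesis .
    qed
    have g_le: "\<bar>?g p\<bar> \<le> sup_norm M ?g" if "p \<in> points M" for p
      unfolding sup_norm_def using upper that by (intro cSUP_upper bdd_aboveI2) auto
    then have "(?g p)\<^sup>2 \<le> (sup_norm M ?g)\<^sup>2" if "p \<in> points M" for p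
      using that by (metis abs_ge_zero power2_abs power_mono)
    moreover have g0: "sup_norm M ?g \<ge> 0" using g_le[OF p0(1)] by linarith
    ultimately have "l * \<bar>e p0\<bar> \<le> C0 * sup_norm M ?g"
      by (intro C0[rule_format, OF p0(1), unfolded gradient_estimates_at_def, rule_format, OF l e,
            THEN conjunct2, rule_format])
    also have "\<dots> \<le> C * sup_norm M ?g" using C(2) g0 by (rule mult_right_mono)
    finally have "l * sup_norm M e / C \<le> sup_norm M ?g"
      using C(3) by (simp add: norm_e divide_le_eq mult.commute)
    moreover have "sup_norm M ?g \<le> C * l * sup_norm M e"
      unfolding norm_e unfolding sup_norm_def using ne upper by (intro cSUP_least)
    ultimately show ?thesis by blast
  qed
  then show ?thesis using C(3) by blast
qed

end
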